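(* Let $G$ be a graph that is not a path. Then $$\mathrm{mci}(G)\le \mathrm{pl}(G)\le 2\,\mathrm{pat}(G)\le 4\,\mathrm{mci}(G)-2,$$ $$\mathrm{mci}(G)\le \Delta(G)\le 4\,\mathrm{mci}(G),$$ $$\frac{\mathrm{mci}(G)-1}{2}\le \mathrm{adc}(G)\le 4\,\mathrm{mci}(G)-2.$$
   Context: All graphs are nonempty, connected, finite, unweighted, undirected, loopless, without multiple edges. "Path" as a graph includes the one-vertex graph. $d_G(u,v)$ is the number of edges of a shortest path of $G$ between $u$ and $v$; $D_G(v,r)=\{u: d_G(u,v)\le r\}$ is the disk of radius $r$ centered at $v$. For an integer $k\ge1$, the power $G^k$ has the same vertex set as $G$, two distinct vertices being adjacent iff their distance in $G$ is at most $k$. The McCarty index $\mathrm{mci}(G)$ is the minimum integer $r\ge 0$ such that for every triple of distinct vertices $u,v,w$ of $G$, the disk of radius $r$ centered at one of them intercepts (contains a vertex of) every path of $G$ connecting the two others. A path-decomposition of $G=(V,E)$ is a sequence $X_1,\dots,X_q$ of subsets of $V$ (bags) such that $\bigcup_i X_i=V$; every edge has both ends in some bag; and $X_i\cap X_k\subseteq X_j$ whenever $i\le j\le k$. Its length is $\max_i\max_{u,v\in X_i} d_G(u,v)$. The path-length $\mathrm{pl}(G)$ is the minimum length over all path-decompositions of $G$. For $s\in V$ let $L_i=\{u\in V: d_G(s,u)=i\}$, $i=0,\dots,q$, with $q=\max_u d_G(s,u)$. For $i\ge 1$ let $L_i^+$ be $L_i$ together with all vertices of $L_{i-1}$ that have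 a neighbor in $L_i$. The sequence $(L_1^+,\dots,L_q^+)$ is a path-decomposition of $G$; $\Delta_s(G)$ denotes its length and $\Delta(G)=\min_{s\in V}\Delta_s(G)$. A caterpillar tree is an (unweighted) tree in which all vertices are within distance 1 of some path of the tree. $\mathrm{adc}(G)$ is the minimum integer $k\ge 0$ such that there is a caterpillar tree $T$ on the vertex set $V$ with $|d_G(u,v)-d_T(u,v)|\le k$ for all $u,v\in V$. An asteroidal triple is an independent set of three vertices such that each two are joined by a path avoiding the closed neighborhood of the third. A graph is AT-free if it has no asteroidal triple. $\mathrm{pat}(G)$ is the minimum integer $k\ge 1$ such that $G^k$ is AT-free. *)

theory Defs
  imports "Graph_Theory.Graph_Theory"
begin

text \<open>Finite simple undirected graphs are the symmetric loop-free pair digraphs of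
  \<^locale>\<open>pair_graph\<close>: an undirected edge is represented by its two opposite arcs.
  Paths are given by their vertex sequences.\<close>

definition path_between :: "'a pair_pre_digraph \<Rightarrow> 'a \<Rightarrow> 'a list \<Rightarrow> 'a \<Rightarrow> bool" where
  "path_between G u p v \<longleftrightarrow> vpath p (with_proj G) \<and> hd p = u \<and> last p = v"

definition path_graph :: "'a pair_pre_digraph \<Rightarrow> bool" where
  "path_graph G \<longleftrightarrow> (\<exists>p. p \<noteq> [] \<and> distinct p \<and> pverts G = set p \<and>
     parcs G = set (vwalk_arcs p) \<union> (set (vwalk_arcs p))\<inverse>)"

text \<open>The distance is only meaningful for vertices joined by a path; all graphs below to which
  it is applied are connected.\<close>

definition gdist :: "'a pair_pre_digraph \<Rightarrow> 'a \<Rightarrow> 'a \<Rightarrow> nat" where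
  "gdist G u v = (LEAST n. \<exists>p. path_between G u p v \<and> vwalk_length p = n)"

definition disk :: "'a pair_pre_digraph \<Rightarrow> 'a \<Rightarrow> nat \<Rightarrow> 'a set" where
  "disk G v r = {u \<in> pverts G. gdist G u v \<le> r}"

definition graph_power :: "'a pair_pre_digraph \<Rightarrow> nat \<Rightarrow> 'a pair_pre_digraph" where
  "graph_power G k = \<lparr> pverts = pverts G,
     parcs = {(u, v). u \<in> pverts G \<and> v \<in> pverts G \<and> u \<noteq> v \<and> gdist G u v \<le> k} \<rparr>"


definition intercepts_all :: "'a pair_pre_digraph \<Rightarrow> 'a set \<Rightarrow> 'a \<Rightarrow> 'a \<Rightarrow> bool" where
  "intercepts_all G D u v \<longleftrightarrow> (\<forall>p. path_between G u p v \<longrightarrow> set p \<inter> D \<noteq> {})"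

definition mci :: "'a pair_pre_digraph \<Rightarrow> nat" where
  "mci G = (LEAST r. \<forall>u\<in>pverts G. \<forall>v\<in>pverts G. \<forall>w\<in>pverts G.
     u \<noteq> v \<and> u \<noteq> w \<and> v \<noteq> w \<longrightarrow>
       intercepts_all G (disk G u r) v w \<or>
       intercepts_all G (disk G v r) u w \<or>
       intercepts_all G (disk G w r) u v)"


definition path_decomposition :: "'a pair_pre_digraph \<Rightarrow> 'a set list \<Rightarrow> bool" where
  "path_decomposition G Xs \<longleftrightarrow>
     \<Union>(set Xs) = pverts G \<and>
     (\<forall>(u, v) \<in> parcs G. \<exists>X\<in>set Xs. u \<in> X \<and> v \<in> X) \<and>
     (\<forall>i j k. i \<le> j \<and> j \<le> k \<and> k < length Xs \<longrightarrow> Xs ! i \<inter> Xs ! k \<subseteq> Xs ! j)"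

text \<open>Inserting 0 only matters when there is no nonempty bag, as for the empty sequence of
  layers of the one-vertex graph.\<close>

definition bags_length :: "'a pair_pre_digraph \<Rightarrow> 'a set list \<Rightarrow> nat" where
  "bags_length G Xs = Max (insert 0 {gdist G u v | X u v. X \<in> set Xs \<and> u \<in> X \<and> v \<in> X})"

definition pl :: "'a pair_pre_digraph \<Rightarrow> nat" where
  "pl G = (LEAST l. \<exists>Xs. path_decomposition G Xs \<and> bags_length G Xs = l)"


definition layer :: "'a pair_pre_digraph \<Rightarrow> 'a \<Rightarrow> nat \<Rightarrow> 'a set" where
  "layer G s i = {u \<in> pverts G. gdist G s u = i}"

text \<open>Used for \<open>i \<ge> 1\<close> only.\<close>

definition layer_plus :: "'a pair_pre_digraph \<Rightarrow> 'a \<Rightarrow> nat \<Rightarrow> 'a set" where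
  "layer_plus G s i =
     layer G s i \<union> {u \<in> layer G s (i - 1). \<exists>v \<in> layer G s i. (u, v) \<in> parcs G}"

definition ecc :: "'a pair_pre_digraph \<Rightarrow> 'a \<Rightarrow> nat" where
  "ecc G s = Max (gdist G s ` pverts G)"

definition Delta_at :: "'a pair_pre_digraph \<Rightarrow> 'a \<Rightarrow> nat" where
  "Delta_at G s = bags_length G (map (layer_plus G s) [1..<Suc (ecc G s)])"

definition Delta :: "'a pair_pre_digraph \<Rightarrow> nat" where
  "Delta G = Min (Delta_at G ` pverts G)"


text \<open>The library predicate \<^const>\<open>tree\<close> does not fit here: in a symmetric digraph an edge
  traversed back and forth is a \<^const>\<open>pre_digraph.cycle\<close> of length 2.\<close>

definition undirected_tree :: "'a pair_pre_digraph \<Rightarrow> bool" where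
  "undirected_tree T \<longleftrightarrow> pair_graph T \<and> Digraph_Component.connected (with_proj T) \<and>
     \<not> (\<exists>c. pre_digraph.cycle (with_proj T) c \<and> 3 \<le> length c)"

definition caterpillar :: "'a pair_pre_digraph \<Rightarrow> bool" where
  "caterpillar T \<longleftrightarrow> undirected_tree T \<and>
     (\<exists>p. vpath p (with_proj T) \<and> (\<forall>v\<in>pverts T. \<exists>x\<in>set p. gdist T v x \<le> 1))"

definition adc :: "'a pair_pre_digraph \<Rightarrow> nat" where
  "adc G = (LEAST k. \<exists>T. caterpillar T \<and> pverts T = pverts G \<and>
     (\<forall>u\<in>pverts G. \<forall>v\<in>pverts G. \<bar>int (gdist G u v) - int (gdist T u v)\<bar> \<le> int k))"


definition closed_nbhd :: "'a pair_pre_digraph \<Rightarrow> 'a \<Rightarrow> 'a set" where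
  "closed_nbhd G v = insert v {u. (v, u) \<in> parcs G}"

definition joined_avoiding :: "'a pair_pre_digraph \<Rightarrow> 'a set \<Rightarrow> 'a \<Rightarrow> 'a \<Rightarrow> bool" where
  "joined_avoiding G S u v \<longleftrightarrow> (\<exists>p. path_between G u p v \<and> set p \<inter> S = {})"

definition asteroidal_triple :: "'a pair_pre_digraph \<Rightarrow> 'a \<Rightarrow> 'a \<Rightarrow> 'a \<Rightarrow> bool" where
  "asteroidal_triple G u v w \<longleftrightarrow>
     u \<in> pverts G \<and> v \<in> pverts G \<and> w \<in> pverts G \<and>
     u \<noteq> v \<and> u \<noteq> w \<and> v \<noteq> w \<and>
     (u, v) \<notin> parcs G \<and> (u, w) \<notin> parcs G \<and> (v, w) \<notin> parcs G \<and>
     joined_avoiding G (closed_nbhd G w) u v \<and>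
     joined_avoiding G (closed_nbhd G v) u w \<and>
     joined_avoiding G (closed_nbhd G u) v w"

definition AT_free :: "'a pair_pre_digraph \<Rightarrow> bool" where
  "AT_free G \<longleftrightarrow> \<not> (\<exists>u v w. asteroidal_triple G u v w)"

definition pat :: "'a pair_pre_digraph \<Rightarrow> nat" where
  "pat G = (LEAST k. 1 \<le> k \<and> AT_free (graph_power G k))"

end

theory Submission
  imports Defs
begin

text \<open>
  A bag of a path-decomposition separates the vertices to its left from those to its right, which
  gives \<open>mci \<le> pl\<close> and, for the layers \<open>L\<^sub>i\<^sup>+\<close>, \<open>mci \<le> \<Delta>\<close>. For \<open>r = mci G \<ge> 1\<close> a
  path of \<open>G\<^sup>k\<close>, \<open>k = 2r - 1\<close>, avoiding the disk of radius \<open>k\<close> around \<open>u\<close> expands to a walk of \<open>G\<close>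
  avoiding the disk of radius \<open>r\<close>, so \<open>G\<^sup>k\<close> is AT-free.

  An AT-free connected graph has an \<^emph>\<open>admissible\<close> vertex \<open>s\<close>: there are no \<open>x\<close>, \<open>y\<close> such that
  \<open>s\<close> reaches \<open>x\<close> off \<open>N[y]\<close> and \<open>y\<close> off \<open>N[x]\<close>. Ordering the vertices \<open>y\<close> by the size of the
  component of \<open>s\<close> off \<open>N[y]\<close> yields a path-decomposition of length at most 2, hence
  \<open>pl G \<le> 2 pat G\<close>. Moreover, if \<open>s\<close> is admissible in \<open>G\<^sup>k\<close>, then any two vertices \<open>x\<close>, \<open>y\<close> of \<open>G\<close>
  at the same distance from \<open>s\<close> have distance at most \<open>2k\<close>: otherwise shortest paths from \<open>s\<close> to
  them avoid the disks of radius \<open>k\<close> around each other. So the layering from \<open>s\<close> has small length,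
  and hanging each layer on a shortest path from \<open>s\<close> to a farthest vertex gives a caterpillar of
  distortion at most \<open>2k\<close>.

  Conversely, in a caterpillar \<open>T\<close> with distortion \<open>k\<close> an edge of \<open>G\<close> whose ends lie on
  different sides of the spine position of \<open>v\<close> has \<open>T\<close>-length at most \<open>k + 1\<close> and passes the spine
  vertex of \<open>v\<close>, so one of its ends is within \<open>2k + 1\<close> of \<open>v\<close> in \<open>G\<close>.
\<close>

section \<open>Connectivity and distances\<close>

lemma vwalk_to_vpath_length: "length (vwalk_to_vpath p) \<le> length p"
proof (induction p rule: vwalk_to_vpath_induct3)
  case (in_set x xs)
  then show ?case using length_dropWhile_le[of "\<lambda>y. y \<noteq> x" xs] by simp
qed auto

text \<open>Removing the loops of a walk keeps a subset of its vertices. Walks, unlike paths,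
  concatenate freely, so connections are built from walks.\<close>

lemma joined_avoidingI_vwalk:
  assumes "vwalk p (with_proj G)" "hd p = u" "last p = v" "set p \<inter> S = {}"
  shows "joined_avoiding G S u v"
  unfolding joined_avoiding_def path_between_def
  using assms vwalk_to_vpath_vpath[of p] vwalk_to_vpath_subset[of _ p]
  by (intro exI[of _ "vwalk_to_vpath p"]) (auto simp: vwalk_to_vpath_hd vwalk_to_vpath_last)

lemma joined_avoidingE:
  assumes "joined_avoiding G S u v"
  obtains p where "vwalk p (with_proj G)" "hd p = u" "last p = v" "set p \<inter> S = {}"
  using assms unfolding joined_avoiding_def path_between_def by auto

lemma joined_avoiding_ends:
  assumes "joined_avoiding G S u v"
  shows "u \<in> pverts G" "v \<in> pverts G" "u \<notin> S" "v \<notin> S"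
proof -
  obtain p where p: "vwalk p (with_proj G)" "hd p = u" "last p = v" "set p \<inter> S = {}"
    using assms by (rule joined_avoidingE)
  have "u \<in> set p" "v \<in> set p" using p by (auto simp: vwalk_def)
  then show "u \<in> pverts G" "v \<in> pverts G" "u \<notin> S" "v \<notin> S" using p by (auto simp: vwalk_def)
qed

lemma joined_avoiding_refl: "u \<in> pverts G \<Longrightarrow> u \<notin> S \<Longrightarrow> joined_avoiding G S u u"
  by (rule joined_avoidingI_vwalk[of "[u]"]) auto

lemma joined_avoiding_trans:
  assumes "joined_avoiding G S u v" "joined_avoiding G S v w"
  shows "joined_avoiding G S u w"
proof -
  obtain p where p: "vwalk p (with_proj G)" "hd p = u" "last p = v" "set p \<inter> S = {}"
    using assms(1) by (rule joined_avoidingE)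
  obtain q where q: "vwalk q (with_proj G)" "hd q = v" "last q = w" "set q \<inter> S = {}"
    using assms(2) by (rule joined_avoidingE)
  have j: "joinable p q" using p q by auto
  show ?thesis
  proof (rule joined_avoidingI_vwalk)
    show "vwalk (p \<oplus> q) (with_proj G)" by (rule vwalk_joinI_vwalk[OF p(1) q(1) j])
    show "hd (p \<oplus> q) = u" "last (p \<oplus> q) = w"
      using p q by (simp_all add: vwalk_join_hd[OF j] vwalk_join_last[OF j])
    have "set (tl q) \<subseteq> set q" by (cases q) auto
    then show "set (p \<oplus> q) \<inter> S = {}" using p(4) q(4) by (auto simp: vwalk_join_def)
  qed
qed

text \<open>The induction runs over the nonempty prefixes of a connecting walk. It turns a
  separation claim into an invariant that is checked on single edges.\<close>

lemma joined_avoiding_induct [consumes 1, case_names base step]: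
  assumes "joined_avoiding G S u v" and "P u"
    and "\<And>x y. joined_avoiding G S u x \<Longrightarrow> (x, y) \<in> parcs G \<Longrightarrow> x \<notin> S \<Longrightarrow> y \<notin> S \<Longrightarrow> P x \<Longrightarrow> P y"
  shows "P v"
proof -
  obtain p where p: "vwalk p (with_proj G)" "hd p = u" "last p = v" "set p \<inter> S = {}"
    using assms(1) by (rule joined_avoidingE)
  have "q \<noteq> [] \<Longrightarrow> \<exists>r. p = q @ r \<Longrightarrow> P (last q)" for q
  proof (induction q rule: rev_induct)
    case (snoc y q)
    show ?case
    proof (cases "q = []")
      case True
      then show ?thesis using snoc.prems p(2) assms(2) by auto
    next
      case False
      then have IH: "P (last q)" using snoc by auto
      obtain r where r: "p = (q @ [y]) @ r" using snoc.prems by auto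
      have w: "vwalk (q @ [y]) (with_proj G)"
        by (rule vwalkI_append_l[where q = r]) (use p(1) r in auto)
      then have wq: "vwalk q (with_proj G)" using False by (rule_tac vwalkI_append_l) auto
      have e: "(last q, y) \<in> parcs G" using w False by (auto simp: vwalk_def set_vwalk_arcs_snoc)
      have "joined_avoiding G S u (last q)"
        by (rule joined_avoidingI_vwalk[OF wq]) (use False r p in \<open>auto simp: hd_append\<close>)
      moreover have "last q \<in> set q" using False by simp
      then have "last q \<notin> S" "y \<notin> S" using p(4) r by auto
      ultimately show ?thesis using assms(3) e IH by auto
    qed
  qed simp
  moreover have "p \<noteq> []" using p(1) by (auto simp: vwalk_def)
  ultimately show ?thesis using p(3) by auto
qed

context pair_graph
begin

lemma arcD: "(x, y) \<in> parcs G \<Longrightarrow> x \<in> pverts G \<and> y \<in> pverts G \<and> x \<noteq> y \<and> (y, x) \<in> parcs G"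
  using no_loops' wellformed' arcs_symmetric by blast

lemma joined_avoiding_edge:
  "(x, y) \<in> parcs G \<Longrightarrow> x \<notin> S \<Longrightarrow> y \<notin> S \<Longrightarrow> joined_avoiding G S x y"
  by (rule joined_avoidingI_vwalk[of "[x, y]"]) (auto dest: arcD simp: vwalk_def)

lemma joined_avoiding_sym: "joined_avoiding G S u v \<Longrightarrow> joined_avoiding G S v u"
proof -
  assume "joined_avoiding G S u v"
  then obtain p where p: "vwalk p (with_proj G)" "hd p = u" "last p = v" "set p \<inter> S = {}"
    by (rule joined_avoidingE)
  then show ?thesis
    using vwalk_rev_ex[OF sym_arcs p(1)]
    by (intro joined_avoidingI_vwalk[of "rev p"]) (simp_all add: hd_rev last_rev)
qed

lemma connectedI_root:
  assumes "s \<in> pverts G" and "\<And>v. v \<in> pverts G \<Longrightarrow> joined_avoiding G {} s v"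
  shows "Digraph_Component.connected (with_proj G)"
proof -
  have r: "u \<rightarrow>\<^sup>*\<^bsub>with_proj G\<^esub> v" if "u \<in> pverts G" "v \<in> pverts G" for u v
  proof -
    have "joined_avoiding G {} u v"
      by (rule joined_avoiding_trans[OF joined_avoiding_sym[OF assms(2)[OF that(1)]] assms(2)[OF that(2)]])
    then show ?thesis unfolding reachable_vwalk_conv by (elim joined_avoidingE) blast
  qed
  show ?thesis
    by (intro connectedI reachable_mk_symmetricI) (use assms(1) r in auto)
qed

end

locale conn_graph = pair_graph +
  assumes conn: "Digraph_Component.connected (with_proj G)"
begin

lemma joined_all: "u \<in> pverts G \<Longrightarrow> v \<in> pverts G \<Longrightarrow> joined_avoiding G {} u v"
proof -
  assume "u \<in> pverts G" "v \<in> pverts G"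
  then have "u \<rightarrow>\<^sup>*\<^bsub>with_proj G\<^esub> v"
    using symmetric_connected_imp_strongly_connected[OF sym_arcs conn]
    by (auto simp: strongly_connected_def)
  then show ?thesis by (auto simp: reachable_vwalk_conv intro: joined_avoidingI_vwalk)
qed

lemma verts_nonempty: "pverts G \<noteq> {}"
  using symmetric_connected_imp_strongly_connected[OF sym_arcs conn]
  by (auto simp: strongly_connected_def)

section \<open>The distance as a metric\<close>

lemma shortest_path_exists:
  assumes "u \<in> pverts G" "v \<in> pverts G"
  obtains p where "path_between G u p v" "length p = Suc (gdist G u v)"
proof -
  obtain p where "path_between G u p v"
    using joined_all[OF assms] by (auto simp: joined_avoiding_def)
  then have "\<exists>p. path_between G u p v \<and> vwalk_length p = gdist G u v"
    unfolding gdist_def by (intro LeastI_ex[of "\<lambda>n. \<exists>p. path_between G u p v \<and> vwalk_length p = n"]) blast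
  then obtain q where q: "path_between G u q v" "vwalk_length q = gdist G u v" by blast
  then have "q \<noteq> []" by (auto simp: path_between_def)
  with q(2) have "length q = Suc (gdist G u v)" by (cases q) auto
  with q(1) show ?thesis by (rule that)
qed

lemma gdist_le_vwalk:
  assumes "vwalk p (with_proj G)" "hd p = u" "last p = v"
  shows "gdist G u v \<le> length p - 1"
proof -
  have "path_between G u (vwalk_to_vpath p) v"
    using assms vwalk_to_vpath_vpath by (auto simp: path_between_def vwalk_to_vpath_hd vwalk_to_vpath_last)
  then have "gdist G u v \<le> vwalk_length (vwalk_to_vpath p)"
    unfolding gdist_def by (intro Least_le) blast
  also have "\<dots> \<le> length p - 1" using vwalk_to_vpath_length[of p] by (simp add: diff_le_mono)
  finally show ?thesis .
qed

lemma gdist_self [simp]: "u \<in> pverts G \<Longrightarrow> gdist G u u = 0"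
  using gdist_le_vwalk[of "[u]" u u] by auto

lemma gdist_sym: "u \<in> pverts G \<Longrightarrow> v \<in> pverts G \<Longrightarrow> gdist G u v = gdist G v u"
proof -
  have "gdist G v u \<le> gdist G u v" if "u \<in> pverts G" "v \<in> pverts G" for u v
  proof -
    obtain p where p: "path_between G u p v" "length p = Suc (gdist G u v)"
      using \<open>u \<in> pverts G\<close> \<open>v \<in> pverts G\<close> by (rule shortest_path_exists)
    then show ?thesis using gdist_le_vwalk[OF vwalk_rev_ex, of p v u] sym_arcs
      by (auto simp: path_between_def hd_rev last_rev)
  qed
  then show "u \<in> pverts G \<Longrightarrow> v \<in> pverts G \<Longrightarrow> gdist G u v = gdist G v u" by (meson antisym)
qed

lemma gdist_tri:
  assumes "u \<in> pverts G" "v \<in> pverts G" "w \<in> pverts G"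
  shows "gdist G u w \<le> gdist G u v + gdist G v w"
proof -
  obtain p where p: "path_between G u p v" "length p = Suc (gdist G u v)"
    using assms(1,2) by (rule shortest_path_exists)
  obtain q where q: "path_between G v q w" "length q = Suc (gdist G v w)"
    using assms(2,3) by (rule shortest_path_exists)
  have j: "joinable p q" using p q by (auto simp: path_between_def)
  have "gdist G u w \<le> length (p \<oplus> q) - 1"
    using p q j by (intro gdist_le_vwalk vwalk_joinI_vwalk)
      (auto simp: path_between_def vwalk_join_hd vwalk_join_last)
  then show ?thesis using p q by (simp add: vwalk_join_def)
qed

lemma gdist_arc_le: "(x, y) \<in> parcs G \<Longrightarrow> gdist G x y \<le> 1"
  using gdist_le_vwalk[of "[x, y]" x y] arcD[of x y] by (auto simp: vwalk_def)

lemma gdist_arc_step: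
  assumes "(x, y) \<in> parcs G" "z \<in> pverts G"
  shows "gdist G z y \<le> Suc (gdist G z x)"
  using gdist_tri[of z x y] gdist_arc_le[OF assms(1)] arcD[OF assms(1)] assms(2) by auto

lemma gdist_Suc_step:
  assumes "u \<in> pverts G" "v \<in> pverts G" "gdist G u v = Suc n"
  obtains w where "(u, w) \<in> parcs G" "gdist G w v = n"
proof -
  obtain p where p: "path_between G u p v" "length p = Suc (Suc n)"
    using assms shortest_path_exists by metis
  then obtain w q where pq: "p = u # w # q"
    by (cases p; cases "tl p") (auto simp: path_between_def)
  then have e: "(u, w) \<in> parcs G" using p by (auto simp: path_between_def vpath_def vwalk_def)
  have "gdist G w v \<le> length (w # q) - 1"
    using p pq by (intro gdist_le_vwalk) (auto simp: path_between_def vpath_def vwalk_def)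
  then have "gdist G w v \<le> n" using p pq by simp
  moreover have "Suc n \<le> 1 + gdist G w v"
    using gdist_tri[of u w v] gdist_arc_le[OF e] arcD[OF e] assms by auto
  ultimately show ?thesis using e by (intro that) auto
qed

lemma gdist_eq_0_iff: "u \<in> pverts G \<Longrightarrow> v \<in> pverts G \<Longrightarrow> gdist G u v = 0 \<longleftrightarrow> u = v"
proof
  assume "u \<in> pverts G" "v \<in> pverts G" "gdist G u v = 0"
  then obtain p where p: "path_between G u p v" "length p = Suc 0"
    by (metis shortest_path_exists)
  then show "u = v" by (cases p) (auto simp: path_between_def)
qed simp

lemma gdist_eq_1_imp_arc:
  assumes "u \<in> pverts G" "v \<in> pverts G" "gdist G u v = 1"
  shows "(u, v) \<in> parcs G"
proof -
  obtain w where "(u, w) \<in> parcs G" "gdist G w v = 0"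
    using assms gdist_Suc_step[of u v 0] by auto
  then show ?thesis using gdist_eq_0_iff[of w v] arcD assms by auto
qed

lemma gdist_less_card: "u \<in> pverts G \<Longrightarrow> v \<in> pverts G \<Longrightarrow> gdist G u v < card (pverts G)"
proof -
  assume "u \<in> pverts G" "v \<in> pverts G"
  then obtain p where p: "path_between G u p v" "length p = Suc (gdist G u v)"
    by (rule shortest_path_exists)
  then have "card (set p) \<le> card (pverts G)" "distinct p"
    by (auto simp: path_between_def vpath_def vwalk_def intro!: card_mono)
  then show ?thesis using p by (simp add: distinct_card)
qed

text \<open>The distance equation says that \<open>z\<close> lies on some shortest path, so no
  particular shortest path has to be named. Read contrapositively, it yields a metrically
  intermediate vertex in any \<open>S\<close> that separates \<open>u\<close> from
  \<open>v\<close>.\<close>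

lemma geodesic_joined:
  assumes "u \<in> pverts G" "v \<in> pverts G"
    and "\<And>z. z \<in> pverts G \<Longrightarrow> gdist G u z + gdist G z v = gdist G u v \<Longrightarrow> z \<notin> S"
  shows "joined_avoiding G S u v"
  using assms
proof (induction "gdist G u v" arbitrary: u)
  case 0
  then have "u = v" using gdist_eq_0_iff[of u v] by auto
  moreover have "u \<notin> S" using 0(4)[of u] 0(2) \<open>u = v\<close> by simp
  ultimately show ?case using joined_avoiding_refl[of u G S] 0(2) by simp
next
  case (Suc n)
  obtain w where w: "(u, w) \<in> parcs G" "gdist G w v = n"
    using Suc.prems Suc.hyps(2) gdist_Suc_step by metis
  have wV: "w \<in> pverts G" using arcD[OF w(1)] by auto
  have "joined_avoiding G S w v"
  proof (rule Suc.hyps(1))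
    fix z assume z: "z \<in> pverts G" "gdist G w z + gdist G z v = gdist G w v"
    \<comment> \<open>A vertex between \<open>w\<close> and \<open>v\<close> is also between
      \<open>u\<close> and \<open>v\<close>, because \<open>w\<close> is one step closer to
      \<open>v\<close>.\<close>
    have "gdist G u z \<le> Suc (gdist G w z)"
      using gdist_tri[of u w z] gdist_arc_le[OF w(1)] Suc.prems z wV by auto
    moreover have "gdist G u v \<le> gdist G u z + gdist G z v" using gdist_tri Suc.prems z by auto
    ultimately have "gdist G u z + gdist G z v = gdist G u v" using z w Suc.hyps(2) by auto
    then show "z \<notin> S" using Suc.prems z by auto
  qed (use w wV Suc.prems in auto)
  moreover have "u \<notin> S" using Suc.prems by auto
  ultimately show ?case
    using joined_avoiding_edge[OF w(1)] joined_avoiding_trans joined_avoiding_ends(3) by metis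
qed

lemma gdist_lipschitz:
  fixes f :: "'a \<Rightarrow> nat"
  assumes "\<And>x y. (x, y) \<in> parcs G \<Longrightarrow> f y \<le> Suc (f x)"
    and "u \<in> pverts G" "v \<in> pverts G"
  shows "f v \<le> f u + gdist G u v"
  using assms(2,3)
proof (induction "gdist G u v" arbitrary: u)
  case 0
  then show ?case using gdist_eq_0_iff by auto
next
  case (Suc n)
  then obtain w where w: "(u, w) \<in> parcs G" "gdist G w v = n"
    using gdist_Suc_step by metis
  then have "f v \<le> f w + n" using Suc.hyps(1)[of w] Suc.prems arcD[OF w(1)] by simp
  then show ?case using assms(1)[OF w(1)] Suc.hyps(2) by simp
qed

end

section \<open>Asteroidal-triple-free graphs\<close>

text \<open>The admissible vertices of the theory of AT-free graphs: no two vertices are unrelated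
  with respect to \<open>s\<close>. Such an \<open>s\<close> behaves like an end of the
  graph.\<close>

definition admissible :: "'a pair_pre_digraph \<Rightarrow> 'a \<Rightarrow> bool" where
  "admissible G s \<longleftrightarrow> s \<in> pverts G \<and>
     \<not> (\<exists>x y. joined_avoiding G (closed_nbhd G y) s x \<and> joined_avoiding G (closed_nbhd G x) s y)"

definition component_off :: "'a pair_pre_digraph \<Rightarrow> 'a set \<Rightarrow> 'a \<Rightarrow> 'a set" where
  "component_off G S u = {w. joined_avoiding G S u w}"

text \<open>A vertex maximising this weight is admissible: if \<open>x\<close>, \<open>y\<close> witness the contrary, they lie in
  distinct components \<open>X\<close>, \<open>Y\<close> off the neighbourhood of \<open>s\<close>. Passing from \<open>s\<close> to \<open>y\<close> destroys
  only \<open>Y\<close> and enlarges \<open>X\<close>. The base 3 makes this a gain as soon as \<open>card Y \<le> card X\<close>.\<close>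

definition admissibility_weight :: "'a pair_pre_digraph \<Rightarrow> 'a \<Rightarrow> nat" where
  "admissibility_weight G s =
     (\<Sum>u\<in>pverts G - closed_nbhd G s. 3 ^ card (component_off G (closed_nbhd G s) u))"

context conn_graph
begin

lemma closed_nbhd_sym: "x \<in> closed_nbhd G y \<longleftrightarrow> y \<in> closed_nbhd G x"
  by (auto simp: closed_nbhd_def dest: arcD)

lemma component_off_subset: "component_off G S u \<subseteq> pverts G"
  by (auto simp: component_off_def dest: joined_avoiding_ends)

lemma finite_component_off [simp]: "finite (component_off G S u)"
  using component_off_subset pair_finite_verts by (rule finite_subset)

lemma component_off_eq:
  assumes "v \<in> component_off G S u"
  shows "component_off G S v = component_off G S u"
proof -
  have uv: "joined_avoiding G S u v" using assms by (simp add: component_off_def)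
  show ?thesis
    using joined_avoiding_trans[OF uv] joined_avoiding_trans[OF joined_avoiding_sym[OF uv]]
    by (auto simp: component_off_def)
qed

text \<open>Since \<open>y\<close> is outside \<open>S\<close> but not in the component of
  \<open>u\<close>, no vertex of that component is adjacent to \<open>y\<close>. A walk inside it
  therefore avoids the closed neighbourhood of \<open>y\<close> as well.\<close>

lemma joined_avoiding_other_nbhd:
  assumes "joined_avoiding G S u w" "\<not> joined_avoiding G S u y" "y \<notin> S" "y \<in> pverts G"
  shows "joined_avoiding G (closed_nbhd G y) u w"
proof -
  have far: "z \<notin> closed_nbhd G y" if z: "joined_avoiding G S u z" for z
  proof
    assume "z \<in> closed_nbhd G y"
    then consider "z = y" | "(z, y) \<in> parcs G" by (auto simp: closed_nbhd_def dest: arcD)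
    then show False
    proof cases
      case 1
      then show ?thesis using z assms(2) by simp
    next
      case 2
      then have "joined_avoiding G S z y"
        using joined_avoiding_ends(4)[OF z] assms(3) by (intro joined_avoiding_edge)
      then show ?thesis using z assms(2) joined_avoiding_trans by metis
    qed
  qed
  show ?thesis
    using assms(1)
  proof (induction rule: joined_avoiding_induct)
    case base
    then show ?case
      using assms(1) far joined_avoiding_ends joined_avoiding_refl by metis
  next
    case (step a b)
    have "joined_avoiding G S u b"
      using step joined_avoiding_edge joined_avoiding_trans by metis
    then have "joined_avoiding G (closed_nbhd G y) a b"
      using far step by (intro joined_avoiding_edge) auto
    then show ?case using step joined_avoiding_trans by metis
  qed
qed

lemma admissibility_weight_less:
  assumes sx: "joined_avoiding G (closed_nbhd G y) s x"
    and sy: "joined_avoiding G (closed_nbhd G x) s y"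
    and nxy: "\<not> joined_avoiding G (closed_nbhd G s) x y"
    and le: "card (component_off G (closed_nbhd G s) y) \<le> card (component_off G (closed_nbhd G s) x)"
  shows "admissibility_weight G s < admissibility_weight G y"
proof -
  let ?N = "closed_nbhd G s" and ?M = "closed_nbhd G y"
  let ?C = "component_off G ?N" and ?D = "component_off G ?M"
  have V: "s \<in> pverts G" "x \<in> pverts G" "y \<in> pverts G"
    using joined_avoiding_ends[OF sx] joined_avoiding_ends[OF sy] by auto
  have xs: "x \<notin> ?N" "y \<notin> ?N"
    using joined_avoiding_ends[OF sx] joined_avoiding_ends[OF sy] closed_nbhd_sym by blast+
  \<comment> \<open>The vertices off the neighbourhood of \<open>s\<close> in neither of the two
    components; \<open>R\<close>, \<open>?C x\<close> and \<open>?C y\<close> partition the range of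
    the sum.\<close>
  define R where "R = pverts G - ?N - ?C x - ?C y"
  have xC: "x \<in> ?C x" "y \<in> ?C y"
    using xs V by (auto simp: component_off_def intro: joined_avoiding_refl)
  have yx: "y \<notin> ?C x" using nxy by (simp add: component_off_def)
  have disj: "?C x \<inter> ?C y = {}"
    using component_off_eq xC yx by blast
  have off: "?C u \<subseteq> pverts G - ?N" for u
    by (auto simp: component_off_def dest: joined_avoiding_ends)
  have split: "pverts G - ?N = R \<union> (?C x \<union> ?C y)" unfolding R_def using off[of x] off[of y] by blast
  have finR: "finite R" unfolding R_def using pair_finite_verts by simp
  have const: "(\<Sum>u\<in>?C z. 3 ^ card (?C u)) = card (?C z) * 3 ^ card (?C z)" for z
    using component_off_eq[of _ ?N z] by simp
  have "admissibility_weight G s = (\<Sum>u\<in>R. 3 ^ card (?C u)) + ((\<Sum>u\<in>?C x. 3 ^ card (?C u)) + (\<Sum>u\<in>?C y. 3 ^ card (?C u)))"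
    unfolding admissibility_weight_def split
    by (subst sum.union_disjoint; (subst sum.union_disjoint)?) (use finR disj in \<open>auto simp: R_def\<close>)
  also have "\<dots> = (\<Sum>u\<in>R. 3 ^ card (?C u)) + (card (?C x) * 3 ^ card (?C x) + card (?C y) * 3 ^ card (?C y))"
    by (simp only: const)
  also have "\<dots> \<le> (\<Sum>u\<in>R. 3 ^ card (?C u)) + 2 * (card (?C x) * 3 ^ card (?C x))"
    using mult_le_mono[OF le power_increasing[OF le, of "3::nat"]] by simp
  \<comment> \<open>The two components contribute at most twice the part of \<open>?C x\<close>, and
    one more unit in its exponent gives three times that part.\<close>
  also have "\<dots> < (\<Sum>u\<in>R. 3 ^ card (?C u)) + card (?C x) * 3 ^ Suc (card (?C x))"
    using xC card_gt_0_iff[of "?C x"] by auto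
  also have "\<dots> \<le> (\<Sum>u\<in>R. 3 ^ card (?D u)) + (\<Sum>u\<in>?C x. 3 ^ card (?D u))"
  proof (rule add_mono)
    \<comment> \<open>A component without \<open>y\<close> survives when the neighbourhood of
      \<open>y\<close> is removed instead of that of \<open>s\<close>.\<close>
    have sub: "?C u \<subseteq> ?D u" if "y \<notin> ?C u" for u
      using that joined_avoiding_other_nbhd[of ?N u _ y] xs V by (auto simp: component_off_def)
    have "y \<notin> ?C u" if "u \<in> R" for u
      using that xC component_off_eq[of y ?N u] V xs
      by (auto simp: R_def component_off_def intro: joined_avoiding_refl)
    then show "(\<Sum>u\<in>R. 3 ^ card (?C u)) \<le> (\<Sum>u\<in>R. (3::nat) ^ card (?D u))"
      by (intro sum_mono power_increasing card_mono sub) auto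
    \<comment> \<open>The component of \<open>x\<close> gains at least \<open>s\<close>, which
      \<open>x\<close> reaches off the neighbourhood of \<open>y\<close>.\<close>
    have "Suc (card (?C x)) \<le> card (?D u)" if u: "u \<in> ?C x" for u
    proof -
      have eq: "?C u = ?C x" using component_off_eq u by auto
      have "joined_avoiding G ?M u x"
        using sub[of u] eq xC yx by (auto simp: component_off_def)
      then have "s \<in> ?D u"
        using joined_avoiding_sym[OF sx] joined_avoiding_trans by (auto simp: component_off_def)
      moreover have "s \<notin> ?C x" using off by (auto simp: closed_nbhd_def)
      moreover have "?C x \<subseteq> ?D u" using sub[of u] eq yx by auto
      ultimately have "card (insert s (?C x)) \<le> card (?D u)" by (intro card_mono) auto
      then show ?thesis using \<open>s \<notin> ?C x\<close> by simp
    qed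
    then have "(\<Sum>u\<in>?C x. 3 ^ Suc (card (?C x))) \<le> (\<Sum>u\<in>?C x. (3::nat) ^ card (?D u))"
      by (intro sum_mono power_increasing) auto
    then show "card (?C x) * 3 ^ Suc (card (?C x)) \<le> (\<Sum>u\<in>?C x. 3 ^ card (?D u))" by simp
  qed
  also have "\<dots> = (\<Sum>u\<in>R \<union> ?C x. 3 ^ card (?D u))"
    by (subst sum.union_disjoint) (use finR in \<open>auto simp: R_def\<close>)
  also have "\<dots> \<le> admissibility_weight G y"
    unfolding admissibility_weight_def
  proof (rule sum_mono2)
    \<comment> \<open>Off the neighbourhood of \<open>s\<close>, the neighbours of \<open>y\<close>
      all lie in \<open>?C y\<close>, so no term over \<open>R\<close> and \<open>?C x\<close> is
      lost.\<close>
    have "u \<notin> ?M" if "u \<in> R \<union> ?C x" for u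
    proof
      assume "u \<in> ?M"
      then have "u = y \<or> (u, y) \<in> parcs G" by (auto simp: closed_nbhd_def dest: arcD)
      moreover have "u \<notin> ?N" using that off[of x] by (auto simp: R_def)
      ultimately have "joined_avoiding G ?N y u"
        using xs V joined_avoiding_edge[of u y ?N] joined_avoiding_sym joined_avoiding_refl by metis
      then show False using that disj by (auto simp: R_def component_off_def)
    qed
    then show "R \<union> ?C x \<subseteq> pverts G - ?M" using off[of x] by (auto simp: R_def)
  qed (use pair_finite_verts in auto)
  finally show ?thesis .
qed

lemma AT_free_imp_admissible:
  assumes "AT_free G"
  obtains s where "admissible G s"
proof -
  have "Max (admissibility_weight G ` pverts G) \<in> admissibility_weight G ` pverts G"
    using pair_finite_verts verts_nonempty by (intro Max_in) auto
  then obtain s where sV: "s \<in> pverts G"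
    and m: "Max (admissibility_weight G ` pverts G) = admissibility_weight G s" by (rule imageE)
  have s: "s \<in> pverts G"
    "\<And>t. t \<in> pverts G \<Longrightarrow> admissibility_weight G t \<le> admissibility_weight G s"
    unfolding m[symmetric] using sV pair_finite_verts by auto
  have "\<not> (joined_avoiding G (closed_nbhd G y) s x \<and> joined_avoiding G (closed_nbhd G x) s y)" for x y
  proof
    assume A: "joined_avoiding G (closed_nbhd G y) s x \<and> joined_avoiding G (closed_nbhd G x) s y"
    have far: "x \<notin> closed_nbhd G s" "y \<notin> closed_nbhd G s" "x \<notin> closed_nbhd G y"
      and V: "x \<in> pverts G" "y \<in> pverts G"
      using A joined_avoiding_ends[of G _ s] closed_nbhd_sym by blast+
    \<comment> \<open>A path from \<open>x\<close> to \<open>y\<close> off the neighbourhood of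
      \<open>s\<close> would complete an asteroidal triple.\<close>
    have nj: "\<not> joined_avoiding G (closed_nbhd G s) x y"
    proof
      assume "joined_avoiding G (closed_nbhd G s) x y"
      then have "asteroidal_triple G s x y"
        using A far V s(1) unfolding asteroidal_triple_def
        by (auto simp: closed_nbhd_def dest: arcD)
      then show False using assms by (auto simp: AT_free_def)
    qed
    then have nj': "\<not> joined_avoiding G (closed_nbhd G s) y x" using joined_avoiding_sym by blast
    \<comment> \<open>Of \<open>x\<close> and \<open>y\<close>, the one with the smaller component
      has a larger weight than \<open>s\<close>, against the maximality of \<open>s\<close>.\<close>
    have "admissibility_weight G s < admissibility_weight G y \<or> admissibility_weight G s < admissibility_weight G x"
      using admissibility_weight_less[of y s x] admissibility_weight_less[of x s y] A nj nj'
        nat_le_linear by blast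
    then show False using s(2) V by (meson not_less)
  qed
  then have "admissible G s" using s(1) unfolding admissible_def by blast
  then show ?thesis by (rule that)
qed

lemma component_off_nbhd_mono:
  assumes "b \<in> pverts G" "b \<notin> closed_nbhd G c" "b \<notin> component_off G (closed_nbhd G c) s"
  shows "component_off G (closed_nbhd G c) s \<subseteq> component_off G (closed_nbhd G b) s"
  using joined_avoiding_other_nbhd assms by (auto simp: component_off_def)

text \<open>If \<open>b\<close> were far from \<open>a\<close>, then admissibility and the order force the component of \<open>s\<close> off
  \<open>N[a]\<close> to equal that off \<open>N[b]\<close>; its boundary is then contained in both neighbourhoods.\<close>

lemma admissible_order:
  assumes adm: "admissible G s"
  defines "f \<equiv> \<lambda>y. card (component_off G (closed_nbhd G y) s)"
  assumes V: "a \<in> pverts G" "b \<in> pverts G" "c \<in> pverts G"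
    and le: "f a \<le> f b" "f b \<le> f c" and ac: "(a, c) \<in> parcs G"
  shows "gdist G a b \<le> 2"
proof (rule ccontr)
  assume far: "\<not> gdist G a b \<le> 2"
  let ?N = "closed_nbhd G"
  let ?C = "\<lambda>y. component_off G (?N y) s"
  have near: "gdist G u z \<le> 1" if "z \<in> ?N u" "u \<in> pverts G" for u z
    using that gdist_arc_le by (auto simp: closed_nbhd_def)
  have disj: "?N a \<inter> ?N b = {}"
  proof (rule ccontr)
    assume "?N a \<inter> ?N b \<noteq> {}"
    then obtain z where z: "z \<in> ?N a" "z \<in> ?N b" by auto
    then have zV: "z \<in> pverts G" using V by (auto simp: closed_nbhd_def dest: arcD)
    then show False using near[OF z(1)] near[OF z(2)] gdist_tri[of a z b] gdist_sym[of z b] V far by auto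
  qed
  have self: "u \<in> ?N u" "u \<notin> ?C u" for u
    by (auto simp: closed_nbhd_def component_off_def dest: joined_avoiding_ends)
  have ab: "a \<notin> ?N b" "b \<notin> ?N a" using disj self by blast+
  have cN: "c \<in> ?N a" "c \<notin> ?N b" using ac disj by (auto simp: closed_nbhd_def)
  have adm': "v \<notin> ?C u" if "u \<in> ?C v" for u v
    using that adm by (auto simp: admissible_def component_off_def)
  \<comment> \<open>By admissibility \<open>v\<close> is not in \<open>?C u\<close>, so
    \<open>?C u\<close> is contained in \<open>?C v\<close>, and \<open>u\<close> belongs only to
    the latter.\<close>
  have strict: "f u < f v" if "u \<in> ?C v" "v \<in> pverts G" for u v
  proof -
    have "v \<notin> ?N u" using that closed_nbhd_sym by (auto simp: component_off_def dest: joined_avoiding_ends)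
    then have "?C u \<subseteq> ?C v" using component_off_nbhd_mono that adm' by auto
    then show ?thesis unfolding f_def using that self by (intro psubset_card_mono) auto
  qed
  \<comment> \<open>The edge from \<open>a\<close> to \<open>c\<close> avoids the neighbourhood of
    \<open>b\<close>; together with \<open>a\<close>, also \<open>c\<close> would lie in
    \<open>?C b\<close>, giving \<open>f c < f b\<close>.\<close>
  have aCb: "a \<notin> ?C b"
  proof
    assume "a \<in> ?C b"
    moreover have "joined_avoiding G (?N b) a c" using ac ab cN by (intro joined_avoiding_edge)
    ultimately have "c \<in> ?C b" using joined_avoiding_trans by (auto simp: component_off_def)
    then show False using strict V le(2) by (meson not_less)
  qed
  have bCa: "b \<notin> ?C a" using strict V le(1) by (meson not_less)
  have eq: "?C a = ?C b"
    using component_off_nbhd_mono[of b a s] component_off_nbhd_mono[of a b s] V ab aCb bCa by auto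
  have sV: "s \<in> pverts G" using adm by (simp add: admissible_def)
  have "s \<in> ?C a"
  proof (rule ccontr)
    assume "s \<notin> ?C a"
    then have "s \<in> ?N a" "s \<in> ?N b"
      using eq sV by (auto simp: component_off_def intro: joined_avoiding_refl)
    then show False using disj by auto
  qed
  obtain K where K: "K = ?C a" "K = ?C b" using eq by blast
  \<comment> \<open>An edge leaving \<open>K\<close> would end in the neighbourhoods of both
    \<open>a\<close> and \<open>b\<close>, which are disjoint. Hence \<open>K\<close> contains
    everything reachable from \<open>s\<close>, but \<open>a\<close> is not in it.\<close>
  have "joined_avoiding G {} s a" using joined_all sV V by auto
  then have "a \<in> K"
  proof (induction rule: joined_avoiding_induct)
    case base
    show ?case using \<open>s \<in> ?C a\<close> K by simp
  next
    case (step x y)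
    have ext: "y \<in> ?C u" if "x \<in> ?C u" "y \<notin> ?N u" for u
      using that step(2) joined_avoiding_edge[of x y "?N u"]
        joined_avoiding_ends(4)[of G "?N u" s x] joined_avoiding_trans[of G "?N u" s x y]
      by (auto simp: component_off_def)
    have "y \<notin> ?N a \<or> y \<notin> ?N b" using disj by auto
    then show ?case using ext[of a] ext[of b] step(5) K by auto
  qed
  then show False using self K by auto
qed

end

section \<open>Path-decompositions\<close>

lemma intercepts_all_iff: "intercepts_all G D u v \<longleftrightarrow> \<not> joined_avoiding G D u v"
  by (auto simp: intercepts_all_def joined_avoiding_def)

context conn_graph
begin

text \<open>Any placement on a line puts one vertex of each triple in the middle, and the disk of
  that vertex can serve. Ties are allowed, so \<open>pos\<close> may identify vertices.\<close>

lemma mci_le_of_pos: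
  fixes pos :: "'a \<Rightarrow> nat"
  assumes sep: "\<And>u v w. u \<in> pverts G \<Longrightarrow> v \<in> pverts G \<Longrightarrow> w \<in> pverts G \<Longrightarrow>
      u \<noteq> v \<Longrightarrow> u \<noteq> w \<Longrightarrow> v \<noteq> w \<Longrightarrow> pos u \<le> pos v \<Longrightarrow> pos v \<le> pos w \<Longrightarrow>
      \<not> joined_avoiding G (disk G v r) u w"
  shows "mci G \<le> r"
  unfolding mci_def
proof (intro Least_le ballI impI, elim conjE)
  fix u v w
  assume A: "u \<in> pverts G" "v \<in> pverts G" "w \<in> pverts G" "u \<noteq> v" "u \<noteq> w" "v \<noteq> w"
  consider "pos u \<le> pos v \<and> pos v \<le> pos w" | "pos w \<le> pos v \<and> pos v \<le> pos u"
    | "pos v \<le> pos u \<and> pos u \<le> pos w" | "pos w \<le> pos u \<and> pos u \<le> pos v"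
    | "pos u \<le> pos w \<and> pos w \<le> pos v" | "pos v \<le> pos w \<and> pos w \<le> pos u"
    by linarith
  then have "\<not> joined_avoiding G (disk G u r) v w \<or> \<not> joined_avoiding G (disk G v r) u w \<or>
    \<not> joined_avoiding G (disk G w r) u v"
    by cases (metis A sep joined_avoiding_sym)+
  then show "intercepts_all G (disk G u r) v w \<or> intercepts_all G (disk G v r) u w \<or>
    intercepts_all G (disk G w r) u v"
    by (simp add: intercepts_all_iff)
qed

lemma mci_property:
  assumes "u \<in> pverts G" "v \<in> pverts G" "w \<in> pverts G" "u \<noteq> v" "u \<noteq> w" "v \<noteq> w"
  shows "\<not> joined_avoiding G (disk G u (mci G)) v w \<or> \<not> joined_avoiding G (disk G v (mci G)) u w \<or>
    \<not> joined_avoiding G (disk G w (mci G)) u v"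
proof -
  let ?P = "\<lambda>r. \<forall>u\<in>pverts G. \<forall>v\<in>pverts G. \<forall>w\<in>pverts G. u \<noteq> v \<and> u \<noteq> w \<and> v \<noteq> w \<longrightarrow>
       intercepts_all G (disk G u r) v w \<or> intercepts_all G (disk G v r) u w \<or>
       intercepts_all G (disk G w r) u v"
  have "disk G u (card (pverts G)) = pverts G" if "u \<in> pverts G" for u
    using that gdist_less_card by (auto simp: disk_def less_imp_le)
  then have "?P (card (pverts G))"
    using joined_avoiding_ends(1,3) by (fastforce simp: intercepts_all_iff)
  then have "?P (mci G)" unfolding mci_def by (rule LeastI)
  then show ?thesis using assms by (simp add: intercepts_all_iff)
qed

text \<open>The bags containing a vertex form an interval, so for a vertex off \<open>S\<close> this
  interval lies on one side of \<open>j\<close>. The ends of an edge share a bag, so the side never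
  changes along a walk off \<open>S\<close>.\<close>

lemma path_decomposition_separates:
  assumes pd: "path_decomposition G Xs" and ij: "i \<le> j" "j \<le> k" "k < length Xs"
    and u: "u \<in> Xs ! i" and w: "w \<in> Xs ! k" and S: "Xs ! j \<subseteq> S"
  shows "\<not> joined_avoiding G S u w"
proof
  assume J: "joined_avoiding G S u w"
  have convex: "Xs ! i \<inter> Xs ! k \<subseteq> Xs ! j" if "i \<le> j" "j \<le> k" "k < length Xs" for i j k
    using pd that unfolding path_decomposition_def by blast
  have left: "\<forall>m<length Xs. x \<in> Xs ! m \<longrightarrow> m < j"
    if "x \<in> Xs ! l" "l < j" "x \<notin> S" for x l
  proof (intro allI impI)
    fix m assume "m < length Xs" "x \<in> Xs ! m"
    then show "m < j" using convex[of l j m] that S by (cases "m < j") auto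
  qed
  have "\<forall>m<length Xs. w \<in> Xs ! m \<longrightarrow> m < j"
    using J
  proof (induction rule: joined_avoiding_induct)
    case base
    have "u \<notin> S" using joined_avoiding_ends[OF J] by simp
    moreover from this have "i \<noteq> j" using u S by auto
    ultimately show ?case using left[of u i] u ij by auto
  next
    case (step x y)
    obtain X where "X \<in> set Xs" "x \<in> X" "y \<in> X"
      using pd step(2) unfolding path_decomposition_def by blast
    then obtain l where l: "l < length Xs" "x \<in> Xs ! l" "y \<in> Xs ! l" by (auto simp: in_set_conv_nth)
    then show ?case using step left[of y l] by blast
  qed
  then show False using w ij by auto
qed

lemma finite_bag_distances:
  assumes "\<Union>(set Xs) \<subseteq> pverts G"
  shows "finite {gdist G u v | X u v. X \<in> set Xs \<and> u \<in> X \<and> v \<in> X}"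
proof (rule finite_subset)
  show "{gdist G u v | X u v. X \<in> set Xs \<and> u \<in> X \<and> v \<in> X} \<subseteq> {..card (pverts G)}"
  proof
    fix d assume "d \<in> {gdist G u v | X u v. X \<in> set Xs \<and> u \<in> X \<and> v \<in> X}"
    then obtain X u v where "d = gdist G u v" "X \<in> set Xs" "u \<in> X" "v \<in> X" by blast
    moreover from this have "u \<in> pverts G" "v \<in> pverts G" using assms by blast+
    ultimately show "d \<in> {..card (pverts G)}" using gdist_less_card[of u v] by simp
  qed
qed simp

lemma gdist_le_bags_length:
  assumes "\<Union>(set Xs) \<subseteq> pverts G" "X \<in> set Xs" "u \<in> X" "v \<in> X"
  shows "gdist G u v \<le> bags_length G Xs"
  unfolding bags_length_def using finite_bag_distances[OF assms(1)] assms(2-)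
  by (intro Max_ge) auto

lemma bags_length_le:
  assumes "\<Union>(set Xs) \<subseteq> pverts G"
    and "\<And>X u v. X \<in> set Xs \<Longrightarrow> u \<in> X \<Longrightarrow> v \<in> X \<Longrightarrow> gdist G u v \<le> l"
  shows "bags_length G Xs \<le> l"
  unfolding bags_length_def using finite_bag_distances[OF assms(1)] assms(2)
  by (intro Max.boundedI) auto

text \<open>Each vertex is placed at the first bag containing it. That bag lies in the disk around
  the vertex whose radius is the length of the decomposition, so the disk separates whatever the bag
  separates.\<close>

lemma mci_le_bags_length:
  assumes pd: "path_decomposition G Xs"
  shows "mci G \<le> bags_length G Xs"
proof -
  have un: "\<Union>(set Xs) = pverts G" using pd by (simp add: path_decomposition_def)
  define pos where "pos x = (LEAST i. i < length Xs \<and> x \<in> Xs ! i)" for x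
  have pos: "pos x < length Xs \<and> x \<in> Xs ! pos x" if "x \<in> pverts G" for x
  proof -
    have "\<exists>i. i < length Xs \<and> x \<in> Xs ! i" using that un[symmetric] by (auto simp: in_set_conv_nth)
    then show ?thesis unfolding pos_def by (rule LeastI_ex)
  qed
  show ?thesis
  proof (rule mci_le_of_pos)
    fix u v w
    assume A: "u \<in> pverts G" "v \<in> pverts G" "w \<in> pverts G" and le: "pos u \<le> pos v" "pos v \<le> pos w"
    have "Xs ! pos v \<subseteq> disk G v (bags_length G Xs)"
      using gdist_le_bags_length[of Xs "Xs ! pos v" _ v] pos[OF A(2)] un by (auto simp: disk_def)
    then show "\<not> joined_avoiding G (disk G v (bags_length G Xs)) u w"
      using path_decomposition_separates[OF pd le] pos A by blast
  qed
qed

lemma pl_attained: obtains Xs where "path_decomposition G Xs" "bags_length G Xs = pl G"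
proof -
  have "path_decomposition G [pverts G]" by (auto simp: path_decomposition_def dest: arcD)
  then have "\<exists>Xs. path_decomposition G Xs \<and> bags_length G Xs = pl G"
    unfolding pl_def by (intro LeastI_ex[of "\<lambda>l. \<exists>Xs. path_decomposition G Xs \<and> bags_length G Xs = l"]) blast
  then show ?thesis using that by blast
qed

lemma mci_le_pl: "mci G \<le> pl G"
  using pl_attained mci_le_bags_length by metis

text \<open>Sort the vertices by \<open>f\<close> as \<open>v\<^sub>0, v\<^sub>1, \<dots>\<close>; the bag of \<open>v\<^sub>i\<close> consists of \<open>v\<^sub>i\<close> and the
  earlier vertices with a neighbour not before \<open>v\<^sub>i\<close>.\<close>

lemma pl_le_of_order:
  fixes f :: "'a \<Rightarrow> nat"
  assumes "\<And>a b c. a \<in> pverts G \<Longrightarrow> b \<in> pverts G \<Longrightarrow> c \<in> pverts G \<Longrightarrow>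
    f a \<le> f b \<Longrightarrow> f b \<le> f c \<Longrightarrow> (a, c) \<in> parcs G \<Longrightarrow> gdist G a b \<le> l"
  shows "pl G \<le> l"
proof -
  obtain vs0 where "set vs0 = pverts G" "distinct vs0"
    using finite_distinct_list pair_finite_verts by blast
  then obtain vs where vs: "set vs = pverts G" "sorted (map f vs)" and dist: "distinct vs"
    by (metis set_sort distinct_sort sorted_sort_key)
  have mono: "f (vs ! i) \<le> f (vs ! j)" if "i \<le> j" "j < length vs" for i j
    using sorted_nth_mono[OF vs(2), of i j] that by simp
  define bag where "bag i = {vs ! j | j. j \<le> i \<and> (j = i \<or> (\<exists>m\<ge>i. m < length vs \<and> (vs ! j, vs ! m) \<in> parcs G))}" for i
  let ?Xs = "map bag [0..<length vs]"
  have bag_sub: "bag i \<subseteq> pverts G" if "i < length vs" for i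
    using that vs(1) by (auto simp: bag_def dest: nth_mem arcD)
  have nth_bag: "vs ! i \<in> bag i" for i by (auto simp: bag_def)
  have edge: "\<exists>X\<in>set ?Xs. u \<in> X \<and> v \<in> X" if uv: "(u, v) \<in> parcs G" for u v
  proof -
    obtain i j where ij: "i < length vs" "j < length vs" "vs ! i = u" "vs ! j = v"
      using arcD[OF uv] vs(1) by (metis in_set_conv_nth)
    have "u \<in> bag (max i j) \<and> v \<in> bag (max i j)"
      using ij uv arcD[OF uv] nth_bag[of i] nth_bag[of j]
      by (cases "i \<le> j") (force simp: bag_def max_def)+
    then show ?thesis using ij by (intro bexI[of _ "bag (max i j)"]) auto
  qed
  have pd: "path_decomposition G ?Xs"
    unfolding path_decomposition_def
  proof (intro conjI allI impI ballI)
    show "\<Union> (set ?Xs) = pverts G"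
    proof
      show "\<Union> (set ?Xs) \<subseteq> pverts G" using bag_sub by fastforce
      show "pverts G \<subseteq> \<Union> (set ?Xs)" using nth_bag vs(1) by (force simp: in_set_conv_nth)
    qed
    show "case e of (u, v) \<Rightarrow> \<exists>X\<in>set ?Xs. u \<in> X \<and> v \<in> X" if "e \<in> parcs G" for e
      using edge that by (cases e) blast
    show "?Xs ! i \<inter> ?Xs ! k \<subseteq> ?Xs ! j" if "i \<le> j \<and> j \<le> k \<and> k < length ?Xs" for i j k
    proof
      fix x assume "x \<in> ?Xs ! i \<inter> ?Xs ! k"
      then have x: "x \<in> bag i" "x \<in> bag k" using that by auto
      obtain a where a: "x = vs ! a" "a \<le> i" using x(1) unfolding bag_def by blast
      obtain b where b: "x = vs ! b" "b \<le> k" "b = k \<or> (\<exists>m\<ge>k. m < length vs \<and> (vs ! b, vs ! m) \<in> parcs G)"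
        using x(2) unfolding bag_def by blast
      have "a = b" using a b that nth_eq_iff_index_eq[OF dist, of a b] by simp
      then have "a = j \<or> (\<exists>m\<ge>j. m < length vs \<and> (vs ! a, vs ! m) \<in> parcs G)"
        using a b that by (metis le_antisym order_trans)
      then have "x \<in> bag j" using a that unfolding bag_def by auto
      then show "x \<in> ?Xs ! j" using that by simp
    qed
  qed
  have "gdist G x y \<le> l" if "X \<in> set ?Xs" "x \<in> X" "y \<in> X" for X x y
  proof -
    obtain i where i: "i < length vs" "X = bag i" using \<open>X \<in> set ?Xs\<close> by auto
    \<comment> \<open>Unless \<open>j = i\<close>, the vertex \<open>vs ! j\<close> has a neighbour
      \<open>vs ! m\<close> with \<open>m\<close> at least \<open>i\<close>. A vertex of the bag
      that is not earlier than \<open>vs ! j\<close> lies between these two in the order, which is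
      the situation of the hypothesis.\<close>
    have le: "gdist G (vs ! j) (vs ! j') \<le> l"
      if hyp: "j \<le> j'" "j' \<le> i" "j = i \<or> (\<exists>m\<ge>i. m < length vs \<and> (vs ! j, vs ! m) \<in> parcs G)" for j j'
    proof (cases "j = i")
      case True
      then have "j' = j" using that by simp
      then show ?thesis using True i(1) nth_mem[of i vs] vs(1) gdist_self by auto
    next
      case False
      then obtain m where "i \<le> m" "m < length vs" "(vs ! j, vs ! m) \<in> parcs G" using hyp(3) by auto
      moreover have "vs ! l \<in> pverts G" if "l < length vs" for l using that vs(1) nth_mem by metis
      ultimately show ?thesis
        using hyp i(1) mono[of j j'] mono[of j' m] by (intro assms[of _ _ "vs ! m"]) auto
    qed
    obtain j where j: "x = vs ! j" "j \<le> i" "j = i \<or> (\<exists>m\<ge>i. m < length vs \<and> (vs ! j, vs ! m) \<in> parcs G)"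
      using \<open>x \<in> X\<close> i(2) by (auto simp: bag_def)
    obtain j' where j': "y = vs ! j'" "j' \<le> i" "j' = i \<or> (\<exists>m\<ge>i. m < length vs \<and> (vs ! j', vs ! m) \<in> parcs G)"
      using \<open>y \<in> X\<close> i(2) by (auto simp: bag_def)
    have "x \<in> pverts G" "y \<in> pverts G" using that bag_sub i by auto
    then show ?thesis
      using le[of j j'] le[of j' j] j j' gdist_sym[of x y] by (cases "j \<le> j'") auto
  qed
  then have "bags_length G ?Xs \<le> l" using bag_sub by (intro bags_length_le) fastforce+
  moreover have "pl G \<le> bags_length G ?Xs" unfolding pl_def using pd by (intro Least_le) blast
  ultimately show ?thesis by simp
qed

section \<open>The layers around a vertex\<close>

lemma layer_plus_cases: "u \<in> layer_plus G s i \<Longrightarrow> u \<in> pverts G \<and> (gdist G s u = i \<or> gdist G s u = i - 1)"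
  by (auto simp: layer_plus_def layer_def)

lemma gdist_le_ecc: "u \<in> pverts G \<Longrightarrow> gdist G s u \<le> ecc G s"
  unfolding ecc_def using pair_finite_verts by (intro Max_ge) auto

text \<open>The second vertex \<open>t\<close> gives \<open>s\<close> a neighbour, which puts
  \<open>s\<close> into the first bag; a one-vertex graph has no bag at all.\<close>

lemma layering_path_decomposition:
  assumes s: "s \<in> pverts G" and t: "t \<in> pverts G" "t \<noteq> s"
  shows "path_decomposition G (map (layer_plus G s) [1..<Suc (ecc G s)])" (is "path_decomposition G ?Xs")
proof -
  have set_Xs: "set ?Xs = layer_plus G s ` {1..ecc G s}" by auto
  have bag: "layer_plus G s i \<in> set ?Xs" if "1 \<le> i" "i \<le> ecc G s" for i
    unfolding set_Xs using that by simp
  have in_bag: "u \<in> layer_plus G s (gdist G s u)" if "u \<in> pverts G" for u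
    using that by (auto simp: layer_plus_def layer_def)
  have pos: "1 \<le> gdist G s u" if "u \<in> pverts G" "u \<noteq> s" for u
    using that gdist_eq_0_iff[of s u] s by (cases "gdist G s u") auto
  have up: "u \<in> layer_plus G s i \<and> v \<in> layer_plus G s i"
    if "(u, v) \<in> parcs G" "gdist G s v = i" "gdist G s u = i - 1 \<or> gdist G s u = i" for u v i
    using that arcD[OF that(1)] by (auto simp: layer_plus_def layer_def)
  \<comment> \<open>An edge goes into the bag of the level of its farther end, which is at least 1
    because the ends are distinct.\<close>
  have edge: "\<exists>X\<in>set ?Xs. u \<in> X \<and> v \<in> X" if uv: "(u, v) \<in> parcs G" "gdist G s u \<le> gdist G s v" for u v
  proof -
    have V: "u \<in> pverts G" "v \<in> pverts G" "u \<noteq> v" using arcD[OF uv(1)] by auto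
    have "gdist G s v \<le> Suc (gdist G s u)" using gdist_arc_step[OF uv(1) s] .
    then have "gdist G s u = gdist G s v - 1 \<or> gdist G s u = gdist G s v" using uv(2) by auto
    moreover have "v \<noteq> s" using uv(2) V s pos[of u] by auto
    ultimately show ?thesis
      using up[OF uv(1), of "gdist G s v"] bag[of "gdist G s v"] pos[of v] gdist_le_ecc[of v s] V by blast
  qed
  show ?thesis
    unfolding path_decomposition_def
  proof (intro conjI allI impI ballI)
    show "\<Union> (set ?Xs) = pverts G"
    proof
      show "\<Union> (set ?Xs) \<subseteq> pverts G" using layer_plus_cases by auto
      show "pverts G \<subseteq> \<Union> (set ?Xs)"
      proof
        fix u assume u: "u \<in> pverts G"
        show "u \<in> \<Union> (set ?Xs)"
        proof (cases "u = s")
          case False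
          then show ?thesis using in_bag[OF u] bag[of "gdist G s u"] pos[OF u] gdist_le_ecc[OF u, of s] by blast
        next
          case True
          obtain n where "gdist G s t = Suc n" using pos[OF t] by (cases "gdist G s t") auto
          then obtain w where "(s, w) \<in> parcs G" using gdist_Suc_step[OF s t(1)] by metis
          then show ?thesis using edge[of s w] True s by auto
        qed
      qed
    qed
    show "case e of (u, v) \<Rightarrow> \<exists>X\<in>set ?Xs. u \<in> X \<and> v \<in> X" if "e \<in> parcs G" for e
    proof (cases e)
      case (Pair u v)
      then show ?thesis using that edge[of u v] edge[of v u] arcD[of u v]
        by (cases "gdist G s u \<le> gdist G s v") auto
    qed
    \<comment> \<open>List index \<open>m\<close> holds the bag of level \<open>Suc m\<close>. A
      vertex occurs only in the bags of its own level and the next, so two bags sharing it have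
      equal or consecutive indices.\<close>
    have nth: "?Xs ! m = layer_plus G s (Suc m)" if "m < length ?Xs" for m
      using that by (simp del: upt_Suc)
    show "?Xs ! i \<inter> ?Xs ! k \<subseteq> ?Xs ! j" if ijk: "i \<le> j \<and> j \<le> k \<and> k < length ?Xs" for i j k
    proof
      fix u assume "u \<in> ?Xs ! i \<inter> ?Xs ! k"
      then have u: "u \<in> layer_plus G s (Suc i)" "u \<in> layer_plus G s (Suc k)"
        using ijk nth[of i] nth[of k] by (auto simp del: upt_Suc)
      from layer_plus_cases[OF this(1)] layer_plus_cases[OF this(2)] have "j = i \<or> j = k" using ijk by auto
      then show "u \<in> ?Xs ! j" using u ijk nth[of j] by (auto simp del: upt_Suc)
    qed
  qed
qed

lemma mci_le_Delta:
  assumes "u \<in> pverts G" "v \<in> pverts G" "u \<noteq> v"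
  shows "mci G \<le> Delta G"
proof -
  have "mci G \<le> Delta_at G s" if s: "s \<in> pverts G" for s
  proof -
    obtain t where "t \<in> pverts G" "t \<noteq> s" using assms by metis
    then show ?thesis
      unfolding Delta_at_def using mci_le_bags_length[OF layering_path_decomposition[OF s]] by auto
  qed
  then show ?thesis
    unfolding Delta_def using pair_finite_verts verts_nonempty by (intro Min.boundedI) auto
qed

end

section \<open>Graph powers\<close>

lemma set_vwalk_arcs_nth: "set (vwalk_arcs p) = {(p ! i, p ! Suc i) | i. Suc i < length p}"
proof (induction p rule: vwalk_arcs.induct)
  case (3 x y xs)
  show ?case
  proof (intro set_eqI iffI)
    fix e assume "e \<in> set (vwalk_arcs (x # y # xs))"
    then consider "e = (x, y)" | i where "e = ((y # xs) ! i, (y # xs) ! Suc i)" "Suc i < length (y # xs)"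
      using 3 by auto
    then show "e \<in> {((x # y # xs) ! i, (x # y # xs) ! Suc i) | i. Suc i < length (x # y # xs)}"
    proof cases
      case 1
      then show ?thesis by (intro CollectI exI[of _ 0]) auto
    next
      case (2 i)
      then show ?thesis by (intro CollectI exI[of _ "Suc i"]) auto
    qed
  next
    fix e assume "e \<in> {((x # y # xs) ! i, (x # y # xs) ! Suc i) | i. Suc i < length (x # y # xs)}"
    then obtain i where i: "e = ((x # y # xs) ! i, (x # y # xs) ! Suc i)" "Suc i < length (x # y # xs)" by blast
    then show "e \<in> set (vwalk_arcs (x # y # xs))" using 3 by (cases i) auto
  qed
qed auto

lemma vwalk_nth_arc: "vwalk p (with_proj G) \<Longrightarrow> Suc i < length p \<Longrightarrow> (p ! i, p ! Suc i) \<in> parcs G"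
  by (auto simp: vwalk_def set_vwalk_arcs_nth)

lemma (in pair_graph) joined_avoiding_segment:
  assumes "vwalk p (with_proj G)" "i \<le> j" "j < length p" "\<And>m. i \<le> m \<Longrightarrow> m \<le> j \<Longrightarrow> p ! m \<notin> S"
  shows "joined_avoiding G S (p ! i) (p ! j)"
  using assms(2-4)
proof (induction j rule: dec_induct)
  case base
  then show ?case using assms(1) by (intro joined_avoiding_refl) (auto simp: vwalk_def)
next
  case (step j)
  then have "joined_avoiding G S (p ! j) (p ! Suc j)"
    by (intro joined_avoiding_edge vwalk_nth_arc[OF assms(1)]) auto
  then show ?case using step joined_avoiding_trans by fastforce
qed

context conn_graph
begin

text \<open>A longest path is spanning and induced.\<close>

lemma mci_0_imp_path_graph:
  assumes "mci G = 0"
  shows "path_graph G"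
proof -
  have disk0: "disk G u 0 = {u}" if "u \<in> pverts G" for u
    using that gdist_eq_0_iff by (auto simp: disk_def)
  have sep: "\<not> joined_avoiding G {u} v w \<or> \<not> joined_avoiding G {v} u w \<or> \<not> joined_avoiding G {w} u v"
    if "u \<in> pverts G" "v \<in> pverts G" "w \<in> pverts G" "u \<noteq> v" "u \<noteq> w" "v \<noteq> w" for u v w
    using mci_property[OF that] assms disk0 that by simp
  \<comment> \<open>Three neighbours of \<open>x\<close> are pairwise joined through
    \<open>x\<close>, each time avoiding the third, so no vertex has degree 3 or more.\<close>
  have deg2: False if "(x, a) \<in> parcs G" "(x, b) \<in> parcs G" "(x, c) \<in> parcs G" "a \<noteq> b" "a \<noteq> c" "b \<noteq> c" for x a b c
  proof -
    have J: "joined_avoiding G {w} u v"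
      if "(x, u) \<in> parcs G" "(x, v) \<in> parcs G" "(x, w) \<in> parcs G" "w \<noteq> u" "w \<noteq> v" for u v w
    proof (rule joined_avoiding_trans)
      show "joined_avoiding G {w} u x" "joined_avoiding G {w} x v"
        using that arcD by (auto intro!: joined_avoiding_edge)
    qed
    have "a \<in> pverts G" "b \<in> pverts G" "c \<in> pverts G" using that arcD by auto
    then show False using sep[of a b c] J[of a b c] J[of a c b] J[of b c a] that by auto
  qed
  obtain u where u: "u \<in> pverts G" using verts_nonempty by auto
  have bound: "\<forall>q. vpath q (with_proj G) \<longrightarrow> length q < Suc (card (pverts G))"
  proof (intro allI impI)
    fix q assume "vpath q (with_proj G)"
    then have "card (set q) = length q" "set q \<subseteq> pverts G"
      by (auto simp: vpath_def vwalk_def distinct_card)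
    then show "length q < Suc (card (pverts G))" using card_mono[OF pair_finite_verts, of "set q"] by simp
  qed
  have "vpath [u] (with_proj G)" by (rule vpath_self) (simp add: u)
  then obtain p where p: "vpath p (with_proj G)"
    and longest: "\<And>q. vpath q (with_proj G) \<Longrightarrow> length q \<le> length p"
    using ex_has_greatest_nat[OF _ bound] by metis
  have walk: "vwalk p (with_proj G)" and dist: "distinct p" and ne: "p \<noteq> []" and pV: "set p \<subseteq> pverts G"
    using p by (auto simp: vpath_def vwalk_def)
  \<comment> \<open>A neighbour off \<open>p\<close> would extend \<open>p\<close> at an end, or
    give an inner vertex a third neighbour.\<close>
  have closed: "y \<in> set p" if xy: "(x, y) \<in> parcs G" and x: "x \<in> set p" for x y
  proof (rule ccontr)
    assume y: "y \<notin> set p"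
    obtain i where i: "i < length p" "x = p ! i" using x by (auto simp: in_set_conv_nth)
    have yx: "(y, x) \<in> parcs G" "y \<in> pverts G" using arcD[OF xy] by auto
    show False
    proof (cases "i = 0")
      case True
      then have "hd p = x" using i ne by (simp add: hd_conv_nth)
      then have "vpath (y # p) (with_proj G)"
        using walk dist y yx vwalk_consI[OF walk, of y] by (simp add: vpath_def)
      then show False using longest[of "y # p"] by simp
    next
      case False
      show False
      proof (cases "Suc i < length p")
        case True
        have "(x, p ! Suc i) \<in> parcs G" using vwalk_nth_arc[OF walk True] i by simp
        moreover have "(p ! (i - 1), x) \<in> parcs G" using vwalk_nth_arc[OF walk, of "i - 1"] False i by simp
        moreover have "p ! Suc i \<noteq> p ! (i - 1)" using dist True i by (simp add: nth_eq_iff_index_eq)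
        moreover have "p ! Suc i \<in> set p" "p ! (i - 1) \<in> set p" using True by auto
        ultimately show False 
          using deg2[of x "p ! Suc i" "p ! (i - 1)" y] xy y arcD[of "p ! (i - 1)" x] by auto
      next
        case last: False
        then have "i = length p - 1" using i by linarith
        then have "last p = x" using i ne by (simp add: last_conv_nth)
        then have "vpath (p @ [y]) (with_proj G)"
          using walk dist y yx xy ne by (auto simp: vpath_def vwalk_def set_vwalk_arcs_snoc)
        then show False using longest[of "p @ [y]"] by simp
      qed
    qed
  qed
  have "v \<in> set p" if "v \<in> pverts G" for v
  proof -
    have "hd p \<in> pverts G" using ne pV by auto
    then have "joined_avoiding G {} (hd p) v" using joined_all that by auto
    then show ?thesis
    proof (induction rule: joined_avoiding_induct)
      case base
      then show ?case using ne by simp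
    qed (use closed in auto)
  qed
  then have verts: "pverts G = set p" using pV by auto
  \<comment> \<open>A chord from \<open>p ! i\<close> to \<open>p ! j\<close> skipping
    \<open>p ! Suc i\<close> closes a cycle through these three vertices, on which any two are
    joined off the third.\<close>
  have cons: "(p ! i, p ! j) \<in> set (vwalk_arcs p)"
    if e: "(p ! i, p ! j) \<in> parcs G" "i < j" "j < length p" for i j
  proof (cases "j = Suc i")
    case True
    then show ?thesis using that by (auto simp: set_vwalk_arcs_nth)
  next
    case False
    then have ij: "Suc i < j" using that by auto
    have neq: "p ! a \<noteq> p ! b" if "a < b" "b \<le> j" for a b
      using that dist \<open>j < length p\<close> by (simp add: nth_eq_iff_index_eq)
    have "joined_avoiding G {p ! Suc i} (p ! i) (p ! j)"
      using e(1) neq[of i "Suc i"] neq[of "Suc i" j] ij by (intro joined_avoiding_edge) auto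
    moreover have "joined_avoiding G {p ! j} (p ! i) (p ! Suc i)"
      using vwalk_nth_arc[OF walk, of i] neq[of i j] neq[of "Suc i" j] ij that
      by (intro joined_avoiding_edge) auto
    moreover have "joined_avoiding G {p ! i} (p ! Suc i) (p ! j)"
    proof (rule joined_avoiding_segment[OF walk])
      show "p ! m \<notin> {p ! i}" if "Suc i \<le> m" "m \<le> j" for m using neq[of i m] that by auto
    qed (use ij that in auto)
    ultimately show ?thesis
      using sep[of "p ! i" "p ! Suc i" "p ! j"] neq[of i "Suc i"] neq[of "Suc i" j] neq[of i j] ij that pV
      by (auto simp: subset_iff)
  qed
  have "parcs G = set (vwalk_arcs p) \<union> (set (vwalk_arcs p))\<inverse>"
  proof
    show "parcs G \<subseteq> set (vwalk_arcs p) \<union> (set (vwalk_arcs p))\<inverse>"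
    proof
      fix e assume e: "e \<in> parcs G"
      obtain x y where xy: "e = (x, y)" by (cases e)
      have D: "x \<in> set p" "y \<in> set p" "x \<noteq> y" "(y, x) \<in> parcs G" using arcD[of x y] e xy verts by auto
      obtain i j where "x = p ! i" "y = p ! j" "i < length p" "j < length p"
        using D(1,2) by (auto simp: in_set_conv_nth)
      then show "e \<in> set (vwalk_arcs p) \<union> (set (vwalk_arcs p))\<inverse>"
        using cons[of i j] cons[of j i] e xy D by (cases i j rule: linorder_cases) auto
    qed
    show "set (vwalk_arcs p) \<union> (set (vwalk_arcs p))\<inverse> \<subseteq> parcs G"
      using walk arcD by (auto simp: vwalk_def)
  qed
  then show ?thesis unfolding path_graph_def using verts dist ne by blast
qed

section \<open>Powers: distances, path-length and AT-freeness\<close>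

lemma pverts_power [simp]: "pverts (graph_power G k) = pverts G"
  by (simp add: graph_power_def)

lemma parcs_power:
  "(u, v) \<in> parcs (graph_power G k) \<longleftrightarrow> u \<in> pverts G \<and> v \<in> pverts G \<and> u \<noteq> v \<and> gdist G u v \<le> k"
  by (simp add: graph_power_def)

lemma pair_graph_power: "pair_graph (graph_power G k)"
proof
  have "parcs (graph_power G k) \<subseteq> pverts G \<times> pverts G" by (auto simp: parcs_power)
  then show "finite (parcs (graph_power G k))" by (rule finite_subset) (use pair_finite_verts in auto)
  show "symmetric (with_proj (graph_power G k))"
    unfolding symmetric_def by (rule symI) (auto simp: parcs_power gdist_sym)
qed (use pair_finite_verts in \<open>auto simp: graph_power_def\<close>)

lemma joined_avoiding_power:
  assumes "joined_avoiding G S u v" "1 \<le> k"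
  shows "joined_avoiding (graph_power G k) S u v"
proof -
  interpret H: pair_graph "graph_power G k" by (rule pair_graph_power)
  show ?thesis
    using assms(1)
  proof (induction rule: joined_avoiding_induct)
    case base
    then show ?case using joined_avoiding_ends[OF assms(1)] by (intro joined_avoiding_refl) auto
  next
    case (step x y)
    have "(x, y) \<in> parcs (graph_power G k)"
      using arcD[OF step(2)] gdist_arc_le[OF step(2)] assms(2) by (auto simp: parcs_power)
    then show ?case using step H.joined_avoiding_edge joined_avoiding_trans by metis
  qed
qed

lemma conn_graph_power: "1 \<le> k \<Longrightarrow> conn_graph (graph_power G k)"
proof (intro conn_graph.intro pair_graph_power conn_graph_axioms.intro)
  assume k: "1 \<le> k"
  interpret H: pair_graph "graph_power G k" by (rule pair_graph_power)
  obtain s where s: "s \<in> pverts G" using verts_nonempty by auto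
  show "Digraph_Component.connected (with_proj (graph_power G k))"
    by (rule H.connectedI_root[of s]) (use s k joined_all joined_avoiding_power in auto)
qed

lemma closed_nbhd_power:
  "v \<in> pverts G \<Longrightarrow> closed_nbhd (graph_power G k) v = {z \<in> pverts G. gdist G v z \<le> k}"
  by (auto simp: closed_nbhd_def parcs_power)

lemma gdist_le_power:
  assumes "1 \<le> k" "u \<in> pverts G" "v \<in> pverts G"
  shows "gdist G u v \<le> k * gdist (graph_power G k) u v"
proof -
  interpret H: conn_graph "graph_power G k" using assms(1) by (rule conn_graph_power)
  show ?thesis
    using assms(2)
  proof (induction "gdist (graph_power G k) u v" arbitrary: u)
    case 0
    then show ?case using H.gdist_eq_0_iff[of u v] assms(3) by auto
  next
    case (Suc n)
    obtain w where w: "(u, w) \<in> parcs (graph_power G k)" "gdist (graph_power G k) w v = n"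
      using H.gdist_Suc_step[of u v n] Suc.prems Suc.hyps(2) assms(3) by auto
    then have "w \<in> pverts G" "gdist G u w \<le> k" by (auto simp: parcs_power)
    then show ?case
      using gdist_tri[of u w v] Suc.hyps(1)[of w] w(2) Suc.hyps(2)[symmetric] Suc.prems assms(3) by auto
  qed
qed

text \<open>The order comes from the power, the decomposition is one of \<open>G\<close>. Edges of
  \<open>G\<close> are edges of the power, and distance 2 in the power means at most
  \<open>2 * k\<close> in \<open>G\<close>.\<close>

lemma pl_le_AT_free_power:
  assumes "1 \<le> k" "AT_free (graph_power G k)"
  shows "pl G \<le> 2 * k"
proof -
  interpret H: conn_graph "graph_power G k" using assms(1) by (rule conn_graph_power)
  obtain s where s: "admissible (graph_power G k) s" using H.AT_free_imp_admissible[OF assms(2)] .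
  show ?thesis
  proof (rule pl_le_of_order)
    fix a b c
    let ?f = "\<lambda>y. card (component_off (graph_power G k) (closed_nbhd (graph_power G k) y) s)"
    assume A: "a \<in> pverts G" "b \<in> pverts G" "c \<in> pverts G" "?f a \<le> ?f b" "?f b \<le> ?f c" "(a, c) \<in> parcs G"
    have "(a, c) \<in> parcs (graph_power G k)"
      using arcD[OF A(6)] gdist_arc_le[OF A(6)] assms(1) by (auto simp: parcs_power)
    then have "gdist (graph_power G k) a b \<le> 2" using H.admissible_order[OF s] A by auto
    then have "k * gdist (graph_power G k) a b \<le> k * 2" by (rule mult_le_mono2)
    then show "gdist G a b \<le> 2 * k"
      by (rule order_trans[OF gdist_le_power[OF assms(1) A(1,2)], THEN order_trans]) simp
  qed
qed

text \<open>A point of a geodesic of length at most \<open>2r - 1\<close> is within \<open>r - 1\<close> of one of its ends.\<close>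

lemma joined_avoiding_power_imp_disk:
  assumes J: "joined_avoiding (graph_power G (2 * r - 1)) (closed_nbhd (graph_power G (2 * r - 1)) u) v w"
    and u: "u \<in> pverts G" and r: "1 \<le> r"
  shows "joined_avoiding G (disk G u r) v w"
  using J
proof (induction rule: joined_avoiding_induct)
  case base
  have "v \<in> pverts G" "v \<notin> closed_nbhd (graph_power G (2 * r - 1)) u"
    using joined_avoiding_ends[OF J] by auto
  then show ?case using u r gdist_sym[of u v]
    by (intro joined_avoiding_refl) (auto simp: closed_nbhd_power disk_def)
next
  case (step x y)
  have xy: "x \<in> pverts G" "y \<in> pverts G" "gdist G x y \<le> 2 * r - 1"
    using step(2) by (auto simp: parcs_power)
  have "joined_avoiding G (disk G u r) x y"
  proof (rule geodesic_joined)
    fix z assume z: "z \<in> pverts G" "gdist G x z + gdist G z y = gdist G x y"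
    \<comment> \<open>Both ends are at distance at least \<open>2 * r\<close> from \<open>u\<close>
      and one of them is within \<open>r - 1\<close> of \<open>z\<close>, so \<open>z\<close> is at
      distance more than \<open>r\<close> from \<open>u\<close>.\<close>
    have "\<not> gdist G u x \<le> 2 * r - 1" "\<not> gdist G u y \<le> 2 * r - 1"
      using step(3,4) xy u by (auto simp: closed_nbhd_power)
    then show "z \<notin> disk G u r"
      using z xy u gdist_tri[of u z x] gdist_tri[of u z y] gdist_sym[of u z] gdist_sym[of x z]
      by (auto simp: disk_def)
  qed (use xy in auto)
  then show ?case using step(5) joined_avoiding_trans by metis
qed

lemma AT_free_power_mci:
  assumes "1 \<le> mci G"
  shows "AT_free (graph_power G (2 * mci G - 1))"
  unfolding AT_free_def
proof clarify
  fix u v w assume "asteroidal_triple (graph_power G (2 * mci G - 1)) u v w"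
  then show False
    unfolding asteroidal_triple_def using mci_property[of u v w] joined_avoiding_power_imp_disk assms
    by auto
qed

lemma pat_le: "1 \<le> mci G \<Longrightarrow> pat G \<le> 2 * mci G - 1"
  unfolding pat_def using AT_free_power_mci by (intro Least_le) auto

lemma pat_attained:
  assumes "1 \<le> mci G"
  shows "1 \<le> pat G" "AT_free (graph_power G (pat G))"
proof -
  have "1 \<le> pat G \<and> AT_free (graph_power G (pat G))"
    unfolding pat_def by (rule LeastI[of _ "2 * mci G - 1"]) (use assms AT_free_power_mci in auto)
  then show "1 \<le> pat G" "AT_free (graph_power G (pat G))" by auto
qed

end

section \<open>Layerings and caterpillar trees\<close>

context pair_wf_digraph
begin

lemma awalk_verts_nth:
  assumes "awalk u c v" "i < length c"
  shows "c ! i = (awalk_verts u c ! i, awalk_verts u c ! Suc i)"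
  using assms
proof (induction c arbitrary: u i)
  case (Cons e es)
  then have e: "fst e = u" "awalk (snd e) es v" by (auto simp: awalk_Cons_iff)
  show ?case
  proof (cases i)
    case 0
    then show ?thesis using e by (cases e; cases es) (auto simp: awalk_Cons_iff)
  next
    case (Suc j)
    then show ?thesis using Cons.IH[OF e(2), of j] Cons.prems(2) by simp
  qed
qed simp

text \<open>At a vertex of largest rank on a cycle, both neighbours along the cycle are of no larger
  rank, hence equal. On a cycle of length at least 3 they differ.\<close>

lemma no_cycle_of_rank:
  fixes rank :: "'a \<Rightarrow> nat"
  assumes unique: "\<And>x y z. (x, y) \<in> parcs G \<Longrightarrow> (x, z) \<in> parcs G \<Longrightarrow>
      rank y \<le> rank x \<Longrightarrow> rank z \<le> rank x \<Longrightarrow> y = z"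
    and sym: "\<And>x y. (x, y) \<in> parcs G \<Longrightarrow> (y, x) \<in> parcs G"
    and c: "cycle c" "3 \<le> length c"
  shows False
proof -
  obtain u where w: "awalk u c u" and dist: "distinct (tl (awalk_verts u c))"
    using c(1) by (auto simp: cycle_def)
  have ne: "c \<noteq> []" using c(2) by auto
  define vs where "vs = awalk_verts u c"
  have len: "length vs = Suc (length c)" unfolding vs_def using w by (simp add: length_awalk_verts)
  have ends: "vs ! 0 = u" "vs ! length c = u"
    using awalk_ends[OF w] w len unfolding vs_def
    by (auto simp: hd_conv_nth last_conv_nth simp del: awlast_of_awalk)
  have arc: "(vs ! i, vs ! Suc i) \<in> parcs G" if "i < length c" for i
    using awalk_verts_nth[OF w that] w that unfolding vs_def awalk_def by (metis nth_mem subsetD)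
  have neq: "vs ! i \<noteq> vs ! j" if "1 \<le> i" "i < j" "j \<le> length c" for i j
    using dist that len nth_eq_iff_index_eq[of "tl vs" "i - 1" "j - 1"]
    by (auto simp: vs_def[symmetric] nth_tl)
  obtain i where i: "i < length c" "\<And>j. j < length c \<Longrightarrow> rank (vs ! j) \<le> rank (vs ! i)"
  proof -
    have ne: "{..<length c} \<noteq> {}" using c(2) by (auto simp: lessThan_empty_iff)
    have "Max ((\<lambda>i. rank (vs ! i)) ` {..<length c}) \<in> (\<lambda>i. rank (vs ! i)) ` {..<length c}"
      using ne by (intro Max_in) auto
    then obtain i where "i < length c" "Max ((\<lambda>i. rank (vs ! i)) ` {..<length c}) = rank (vs ! i)" by auto
    moreover have "rank (vs ! j) \<le> Max ((\<lambda>i. rank (vs ! i)) ` {..<length c})" if "j < length c" for j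
      using that by (intro Max_ge) auto
    ultimately show ?thesis using that by auto
  qed
  have max: "rank (vs ! j) \<le> rank (vs ! i)" if "j \<le> length c" for j
    using i(2)[of j] i(2)[of 0] i(1) ends that by (cases "j = length c"; cases c) auto
  show False
  proof (cases "i = 0")
    case True
    \<comment> \<open>The list \<open>vs\<close> begins and ends with \<open>u\<close>, so the
      predecessor of its first entry is the last but one.\<close>
    have "(vs ! 0, vs ! (length c - 1)) \<in> parcs G"
    proof -
      have "Suc (length c - 1) = length c" "length c - 1 < length c" using c(2) by linarith+
      then show ?thesis using sym[OF arc[of "length c - 1"]] ends by simp
    qed
    moreover have "vs ! 1 \<noteq> vs ! (length c - 1)" using neq[of 1 "length c - 1"] c(2) by auto
    ultimately show False
      using unique[of "vs ! 0" "vs ! 1" "vs ! (length c - 1)"] arc[of 0] max[of 1] max[of "length c - 1"] True c(2) ne by auto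
  next
    case False
    have "vs ! (i - 1) \<noteq> vs ! Suc i"
    \<comment> \<open>\<open>neq\<close> covers indices from 1 on; for \<open>i = 1\<close> the
      entry at 0 is replaced by the equal one at \<open>length c\<close>.\<close>
    proof (cases "i = 1")
      case True
      then show ?thesis using neq[of 2 "length c"] ends c(2) by (auto simp: numeral_2_eq_2)
    next
      case False
      then show ?thesis using neq[of "i - 1" "Suc i"] \<open>i \<noteq> 0\<close> i(1) by auto
    qed
    then show False
      using unique[of "vs ! i" "vs ! (i - 1)" "vs ! Suc i"] sym[OF arc[of "i - 1"]] arc[of i]
        max[of "i - 1"] max[of "Suc i"] False i(1) by auto
  qed
qed

end

section \<open>Layerings from an admissible vertex of a power\<close>

context conn_graph
begin

lemma admissible_layer_diam:
  assumes adm: "admissible (graph_power G k) s" and k: "1 \<le> k"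
    and V: "x \<in> pverts G" "y \<in> pverts G" and eq: "gdist G s x = gdist G s y"
  shows "gdist G x y \<le> 2 * k"
proof (rule ccontr)
  assume far: "\<not> gdist G x y \<le> 2 * k"
  have s: "s \<in> pverts G" using adm by (simp add: admissible_def)
  have J: "joined_avoiding (graph_power G k) (closed_nbhd (graph_power G k) y) s x"
    if V: "x \<in> pverts G" "y \<in> pverts G" and eq: "gdist G s x = gdist G s y" and far: "\<not> gdist G x y \<le> 2 * k" for x y
  proof (rule joined_avoiding_power[OF _ k], rule geodesic_joined)
    fix z assume z: "z \<in> pverts G" "gdist G s z + gdist G z x = gdist G s x"
    show "z \<notin> closed_nbhd (graph_power G k) y"
    proof
      assume "z \<in> closed_nbhd (graph_power G k) y"
      then have yz: "gdist G y z \<le> k" using V by (simp add: closed_nbhd_power)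
      \<comment> \<open>As \<open>x\<close> and \<open>y\<close> have the same level,
        \<open>z\<close> is no farther from \<open>x\<close> than from \<open>y\<close>, hence
        within \<open>k\<close> of both.\<close>
      moreover have "gdist G s y \<le> gdist G s z + gdist G z y" using gdist_tri s z V by auto
      ultimately have "gdist G z x \<le> k" using z eq gdist_sym[of z y] V by auto
      then show False
        using far yz gdist_tri[of x z y] gdist_sym[of x z] gdist_sym[of z y] V z by auto
    qed
  qed (use s V in auto)
  then show False
    using J[of x y] J[of y x] V eq far gdist_sym[of x y] adm unfolding admissible_def by fastforce
qed

text \<open>Two vertices of a bag on the same level are covered by \<open>diam\<close>. Otherwise
  the lower one has a neighbour on the upper level, which costs one more step.\<close>

lemma Delta_le:
  assumes s: "s \<in> pverts G"
    and diam: "\<And>x y. x \<in> pverts G \<Longrightarrow> y \<in> pverts G \<Longrightarrow> gdist G s x = gdist G s y \<Longrightarrow> gdist G x y \<le> l"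
  shows "Delta G \<le> Suc l"
proof -
  have mixed: "gdist G x y \<le> Suc l"
    if x: "x \<in> layer G s i" and y: "y \<in> pverts G" "(y, v) \<in> parcs G" "v \<in> layer G s i" for x y v i
  proof -
    have "gdist G x v \<le> l" using x y diam[of x v] by (auto simp: layer_def)
    moreover have "gdist G x y \<le> Suc (gdist G x v)"
      using gdist_arc_step[of v y x] arcD[OF y(2)] x by (auto simp: layer_def)
    ultimately show ?thesis by simp
  qed
  have "Delta_at G s \<le> Suc l"
    unfolding Delta_at_def
  proof (rule bags_length_le)
    show "\<Union> (set (map (layer_plus G s) [1..<Suc (ecc G s)])) \<subseteq> pverts G"
      using layer_plus_cases by auto
    fix X x y assume "X \<in> set (map (layer_plus G s) [1..<Suc (ecc G s)])" "x \<in> X" "y \<in> X"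
    then obtain i where i: "x \<in> layer_plus G s i" "y \<in> layer_plus G s i" by auto
    then have V: "x \<in> pverts G" "y \<in> pverts G" using layer_plus_cases by auto
    show "gdist G x y \<le> Suc l"
    proof (cases "gdist G s x = gdist G s y")
      case True
      then show ?thesis using diam V le_SucI by blast
    next
      case False
      then consider v where "x \<in> layer G s i" "(y, v) \<in> parcs G" "v \<in> layer G s i"
        | v where "y \<in> layer G s i" "(x, v) \<in> parcs G" "v \<in> layer G s i"
        using i by (auto simp: layer_plus_def layer_def)
      then show ?thesis
        using mixed V gdist_sym[of x y] by cases metis+
    qed
  qed
  moreover have "Delta G \<le> Delta_at G s" unfolding Delta_def using s pair_finite_verts by (intro Min_le) auto
  ultimately show ?thesis by simp
qed

text \<open>The spine is a shortest path from \<open>s\<close> to a farthest vertex; each further vertex is attached to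
  the spine vertex of its own layer.\<close>

lemma layering_caterpillar:
  assumes s: "s \<in> pverts G"
  obtains T where "caterpillar T" "pverts T = pverts G"
    "\<And>x y. x \<in> pverts G \<Longrightarrow> y \<in> pverts G \<Longrightarrow>
      gdist G s x \<le> gdist G s y + gdist T x y \<and>
      (gdist G s x \<le> gdist G s y \<longrightarrow> gdist G s x + gdist T x y \<le> gdist G s y + 2)"
proof -
  let ?h = "gdist G s"
  define q where "q = ecc G s"
  have "ecc G s \<in> ?h ` pverts G"
    unfolding ecc_def using pair_finite_verts s by (intro Max_in) auto
  then obtain t where t: "t \<in> pverts G" "?h t = q" by (auto simp: q_def)
  obtain p where p: "path_between G s p t" and len: "length p = Suc q"
    using shortest_path_exists[OF s t(1)] t(2) by auto
  have walk: "vwalk p (with_proj G)" and dist: "distinct p" and hd: "p ! 0 = s" and last: "p ! q = t"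
    using p len by (auto simp: path_between_def vpath_def hd_conv_nth last_conv_nth vwalk_def)
  have pV: "p ! i \<in> pverts G" if "i \<le> q" for i using walk len that by (auto simp: vwalk_def)
  have parc: "(p ! i, p ! Suc i) \<in> parcs G" if "i < q" for i using vwalk_nth_arc[OF walk] that len by auto
  \<comment> \<open>Levels grow by at most one per edge and \<open>p\<close> climbs from 0 to
    \<open>q\<close> in \<open>q\<close> steps, so \<open>p ! i\<close> has level exactly
    \<open>i\<close>.\<close>
  have up: "?h (p ! j) \<le> ?h (p ! i) + (j - i)" if "i \<le> j" "j \<le> q" for i j
    using that
  proof (induction j rule: dec_induct)
    case (step j)
    then show ?case using gdist_arc_step[OF parc s, of j] by auto
  qed simp
  have h: "?h (p ! i) = i" if "i \<le> q" for i
    using up[of 0 i] up[of i q] that hd last t s by auto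
  have hq: "?h x \<le> q" if "x \<in> pverts G" for x using gdist_le_ecc[OF that] by (simp add: q_def)
  define A where "A = {(p ! i, p ! Suc i) | i. i < q} \<union> {(x, p ! ?h x) | x. x \<in> pverts G \<and> x \<noteq> p ! ?h x}"
  define T where "T = \<lparr>pverts = pverts G, parcs = A \<union> A\<inverse>\<rparr>"
  have T: "pverts T = pverts G" "parcs T = A \<union> A\<inverse>" by (auto simp: T_def)
  have A_cases: "(\<exists>i<q. x = p ! i \<and> y = p ! Suc i) \<or> (x \<in> pverts G \<and> x \<noteq> p ! ?h x \<and> y = p ! ?h x)"
    if "(x, y) \<in> A" for x y using that by (auto simp: A_def)
  have AV: "x \<in> pverts G \<and> y \<in> pverts G \<and> x \<noteq> y" if "(x, y) \<in> A" for x y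
    using A_cases[OF that]
  proof (elim disjE exE conjE)
    fix i assume "i < q" "x = p ! i" "y = p ! Suc i"
    then show ?thesis using pV[of i] pV[of "Suc i"] arcD[OF parc] by auto
  next
    assume "x \<in> pverts G" "x \<noteq> p ! ?h x" "y = p ! ?h x"
    then show ?thesis using pV hq by auto
  qed
  have no_loop: "(x, x) \<notin> A" for x using AV[of x x] by auto
  interpret T: pair_graph T
  proof
    have "A \<union> A\<inverse> \<subseteq> pverts G \<times> pverts G" using AV by auto
    then show "finite (parcs T)" unfolding T by (rule finite_subset) (use pair_finite_verts in auto)
    show "symmetric (with_proj T)" unfolding symmetric_def by (rule symI) (auto simp: T)
  qed (use AV no_loop pair_finite_verts in \<open>auto simp: T\<close>)
  \<comment> \<open>A spine vertex precedes the leaves hanging from it and those precede the next spine vertex, so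
    every vertex has at most one neighbour that is not of larger rank.\<close>
  define rank where "rank x = 2 * ?h x + (if x = p ! ?h x then 0 else 1)" for x
  have A_rank: "?h y = Suc (?h x) \<and> rank x < rank y \<and> x = p ! (?h y - 1) \<and> y = p ! ?h y \<or>
      ?h y = ?h x \<and> rank y < rank x \<and> y = p ! ?h x \<and> x \<noteq> p ! ?h x" if "(x, y) \<in> A" for x y
    using A_cases[OF that]
  proof (elim disjE exE conjE)
    fix i assume "i < q" "x = p ! i" "y = p ! Suc i"
    then show ?thesis using h[of i] h[of "Suc i"] by (simp add: rank_def)
  next
    assume "x \<in> pverts G" "x \<noteq> p ! ?h x" "y = p ! ?h x"
    then show ?thesis using h[of "?h x"] hq[of x] by (simp add: rank_def)
  qed
  have parent: "y = (if x = p ! ?h x then p ! (?h x - 1) else p ! ?h x)"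
    if "(x, y) \<in> parcs T" "rank y \<le> rank x" for x y
    using that A_rank[of x y] A_rank[of y x] by (auto simp: T)
  have no_cycle: "\<not> (\<exists>c. pre_digraph.cycle (with_proj T) c \<and> 3 \<le> length c)"
  proof clarify
    fix c assume c: "pre_digraph.cycle (with_proj T) c" "3 \<le> length c"
    show False
      by (rule T.no_cycle_of_rank[of rank c]) (use c parent T.arcs_symmetric in metis)+
  qed
  have spine: "joined_avoiding T {} s (p ! i)" if "i \<le> q" for i
    using that
  proof (induction i)
    case 0
    then show ?case using hd s by (auto intro: joined_avoiding_refl simp: T)
  next
    case (Suc i)
    have "(p ! i, p ! Suc i) \<in> parcs T" using Suc.prems by (auto simp: T A_def)
    then show ?case using Suc T.joined_avoiding_edge joined_avoiding_trans by (metis Suc_leD empty_iff)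
  qed
  have leaf: "x = p ! ?h x \<or> (x, p ! ?h x) \<in> parcs T" if "x \<in> pverts G" for x
    using that by (auto simp: T A_def)
  have "joined_avoiding T {} s x" if x: "x \<in> pverts G" for x
    using leaf[OF x] spine[OF hq[OF x]] T.joined_avoiding_edge[of "p ! ?h x" x "{}"] T.arcs_symmetric joined_avoiding_trans
    by (metis empty_iff)
  then have conn_T: "Digraph_Component.connected (with_proj T)"
    by (intro T.connectedI_root[of s]) (use s in \<open>auto simp: T\<close>)
  interpret T: conn_graph T by unfold_locales (rule conn_T)
  have pT: "vpath p (with_proj T)"
    using walk dist len by (auto simp: vpath_def vwalk_def T set_vwalk_arcs_nth A_def)
  have leaf1: "gdist T x (p ! ?h x) \<le> 1" if "x \<in> pverts G" for x
    using leaf[OF that] T.gdist_arc_le[of x "p ! ?h x"] T.gdist_self[of x] that by (auto simp: T)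
  have "caterpillar T"
    unfolding caterpillar_def undirected_tree_def
  proof (intro conjI ballI exI[of _ p])
    show "\<exists>x\<in>set p. gdist T v x \<le> 1" if "v \<in> pverts T" for v
      using leaf1[of v] hq[of v] that len by (intro bexI[of _ "p ! ?h v"]) (auto simp: T)
  qed (use T.pair_graph conn_T no_cycle pT in auto)
  \<comment> \<open>Distances in \<open>T\<close> are at least the difference of levels, since
    levels change by at most one along an edge, and exceed it by at most 2, one for each pendant
    edge.\<close>
  moreover have "?h x \<le> ?h y + gdist T x y \<and>
      (?h x \<le> ?h y \<longrightarrow> ?h x + gdist T x y \<le> ?h y + 2)"
    if V: "x \<in> pverts G" "y \<in> pverts G" for x y
  proof
    have "?h b \<le> Suc (?h a)" if "(a, b) \<in> parcs T" for a b
      using that A_rank[of a b] A_rank[of b a] by (auto simp: T)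
    then show "?h x \<le> ?h y + gdist T x y"
      using T.gdist_lipschitz[of ?h y x] T.gdist_sym[of x y] V by (auto simp: T)
    have seg: "gdist T (p ! i) (p ! j) \<le> j - i" if "i \<le> j" "j \<le> q" for i j
      using that
    proof (induction j rule: dec_induct)
      case base
      then show ?case using T.gdist_self[of "p ! i"] pV by (auto simp: T)
    next
      case (step j)
      have "(p ! j, p ! Suc j) \<in> parcs T" using step by (auto simp: T A_def)
      then show ?case using T.gdist_arc_step[of "p ! j" "p ! Suc j" "p ! i"] step pV[of i] by (auto simp: T)
    qed
    show "?h x \<le> ?h y \<longrightarrow> ?h x + gdist T x y \<le> ?h y + 2"
    proof
      assume le: "?h x \<le> ?h y"
      let ?a = "p ! ?h x" and ?b = "p ! ?h y"
      have VT: "x \<in> pverts T" "y \<in> pverts T" "?a \<in> pverts T" "?b \<in> pverts T" using V pV hq by (auto simp: T)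
      have "gdist T x y \<le> gdist T x ?a + (gdist T ?a ?b + gdist T ?b y)"
        using T.gdist_tri[OF VT(1,3,2)] T.gdist_tri[OF VT(3,4,2)] by simp
      then show "?h x + gdist T x y \<le> ?h y + 2"
        using leaf1[OF V(1)] leaf1[OF V(2)] seg[OF le hq[OF V(2)]] T.gdist_sym[OF VT(4,2)] le by auto
    qed
  qed
  ultimately show ?thesis using that T by blast
qed

text \<open>For levels differing by \<open>m\<close>, the distance lies between \<open>m\<close> and
  \<open>m + l\<close> in \<open>G\<close> and between \<open>m\<close> and \<open>m + 2\<close> in
  \<open>T\<close>. The discrepancy is thus at most \<open>l\<close> once \<open>l\<close> is at
  least 2.\<close>

lemma layering_caterpillar_distortion:
  assumes s: "s \<in> pverts G" and l: "2 \<le> l"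
    and diam: "\<And>x y. x \<in> pverts G \<Longrightarrow> y \<in> pverts G \<Longrightarrow> gdist G s x = gdist G s y \<Longrightarrow> gdist G x y \<le> l"
  obtains T where "caterpillar T" "pverts T = pverts G"
    "\<forall>x\<in>pverts G. \<forall>y\<in>pverts G. \<bar>int (gdist G x y) - int (gdist T x y)\<bar> \<le> int l"
proof -
  obtain T where T: "caterpillar T" "pverts T = pverts G"
    "\<And>x y. x \<in> pverts G \<Longrightarrow> y \<in> pverts G \<Longrightarrow>
      gdist G s x \<le> gdist G s y + gdist T x y \<and>
      (gdist G s x \<le> gdist G s y \<longrightarrow> gdist G s x + gdist T x y \<le> gdist G s y + 2)"
    using layering_caterpillar[OF s] by metis
  interpret T: conn_graph T
    using T(1) by (auto simp: caterpillar_def undirected_tree_def intro: conn_graph.intro conn_graph_axioms.intro)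
  have level: "gdist G x y + gdist G s x \<le> gdist G s y + l"
    if V: "x \<in> pverts G" "y \<in> pverts G" and le: "gdist G s x \<le> gdist G s y" for x y
  proof -
    \<comment> \<open>A discrete intermediate value argument: some shortest path from
      \<open>s\<close> to \<open>y\<close> meets the level of \<open>x\<close>, since a walk from
      \<open>s\<close> missing this level never rises above it.\<close>
    have "\<exists>z. z \<in> pverts G \<and> gdist G s z = gdist G s x \<and> gdist G s z + gdist G z y = gdist G s y"
    proof (rule ccontr)
      assume none: "\<not> ?thesis"
      have J: "joined_avoiding G (layer G s (gdist G s x)) s y"
        by (rule geodesic_joined[OF s V(2)]) (use none in \<open>auto simp: layer_def\<close>)
      have "gdist G s y < gdist G s x"
        using J
      proof (induction rule: joined_avoiding_induct)
        case base
        have "gdist G s s \<noteq> gdist G s x" using joined_avoiding_ends(3)[OF J] s by (simp add: layer_def)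
        then show ?case using s by simp
      next
        case (step a b)
        have "gdist G s b \<noteq> gdist G s x" using step(4) arcD[OF step(2)] by (simp add: layer_def)
        then show ?case using gdist_arc_step[OF step(2) s] step(5) by simp
      qed
      then show False using le by simp
    qed
    then obtain z where z: "z \<in> pverts G" "gdist G s z = gdist G s x"
      "gdist G s z + gdist G z y = gdist G s y" by blast
    then show ?thesis using diam[of x z] z V gdist_tri[of x z y] by auto
  qed
  have "\<bar>int (gdist G x y) - int (gdist T x y)\<bar> \<le> int l"
    if V: "x \<in> pverts G" "y \<in> pverts G" and le: "gdist G s x \<le> gdist G s y" for x y
  proof -
    have "gdist G s y \<le> gdist G s x + gdist G x y" using gdist_tri s V by auto
    moreover have "gdist T y x = gdist T x y" using T.gdist_sym V T(2) by auto
    ultimately show ?thesis using level[OF V le] T(3)[OF V] T(3)[OF V(2,1)] le l by auto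
  qed
  then have "\<forall>x\<in>pverts G. \<forall>y\<in>pverts G. \<bar>int (gdist G x y) - int (gdist T x y)\<bar> \<le> int l"
    using gdist_sym T.gdist_sym T(2) by (metis nat_le_linear)
  then show ?thesis using that T by blast
qed

lemma adc_le:
  assumes "caterpillar T" "pverts T = pverts G"
    "\<forall>x\<in>pverts G. \<forall>y\<in>pverts G. \<bar>int (gdist G x y) - int (gdist T x y)\<bar> \<le> int l"
  shows "adc G \<le> l"
  unfolding adc_def using assms by (intro Least_le) blast

lemma adc_attained:
  assumes "caterpillar T" "pverts T = pverts G"
    "\<forall>x\<in>pverts G. \<forall>y\<in>pverts G. \<bar>int (gdist G x y) - int (gdist T x y)\<bar> \<le> int l"
  obtains T' where "caterpillar T'" "pverts T' = pverts G"
    "\<forall>x\<in>pverts G. \<forall>y\<in>pverts G. \<bar>int (gdist G x y) - int (gdist T' x y)\<bar> \<le> int (adc G)"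
proof -
  let ?P = "\<lambda>k. \<exists>T. caterpillar T \<and> pverts T = pverts G \<and>
     (\<forall>u\<in>pverts G. \<forall>v\<in>pverts G. \<bar>int (gdist G u v) - int (gdist T u v)\<bar> \<le> int k)"
  have "?P l" using assms by blast
  then have "?P (adc G)" unfolding adc_def by (rule LeastI)
  then show ?thesis using that by blast
qed

end

section \<open>From a caterpillar back to separation in the graph\<close>

lemma (in pair_wf_digraph) awalk_vwalk_arcs:
  assumes "vwalk q (with_proj G)"
  shows "awalk (hd q) (vwalk_arcs q) (last q) \<and> awalk_verts (hd q) (vwalk_arcs q) = q"
  using assms
proof (induction q rule: vwalk_induct)
  case (Base u)
  then show ?case by (auto simp: awalk_Nil_iff)
next
  case (Cons u v es)
  then show ?case by (auto simp: awalk_Cons_iff)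
qed

lemma (in pair_wf_digraph) cycle_of_closed_vpath:
  assumes p: "vpath p (with_proj G)" "3 \<le> length p" "(last p, hd p) \<in> parcs G"
  shows "\<exists>c. cycle c \<and> 3 \<le> length c"
proof -
  let ?q = "p @ [hd p]"
  have ne: "p \<noteq> []" using p(2) by auto
  have "vwalk ?q (with_proj G)" using p ne by (auto simp: vpath_def vwalk_def set_vwalk_arcs_snoc)
  from awalk_vwalk_arcs[OF this] have c: "awalk (hd p) (vwalk_arcs ?q) (hd p)"
    "awalk_verts (hd p) (vwalk_arcs ?q) = ?q"
    using ne by auto
  have "distinct (tl ?q)" using p(1) ne by (cases p) (auto simp: vpath_def)
  moreover have "length (vwalk_arcs ?q) = length p"
    using vwalk_length_simp[of ?q, unfolded vwalk_length_def] by simp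
  ultimately show ?thesis using c p(2) unfolding cycle_def by (metis list.size(3) not_numeral_le_zero)
qed

context pair_graph
begin

lemma vpath_segment:
  assumes p: "vpath p (with_proj G)" and ij: "i \<le> j" "j < length p"
  obtains r where "vwalk r (with_proj G)" "distinct r" "set r \<subseteq> set p" "hd r = p ! i" "last r = p ! j"
    "length r = Suc (j - i)"
proof
  let ?r = "map ((!) p) [i..<Suc j]"
  have walk: "vwalk p (with_proj G)" and dist: "distinct p" using p by (auto simp: vpath_def)
  have nth: "?r ! m = p ! (i + m)" if "m < length ?r" for m using that by (simp del: upt_Suc)
  have sub: "set ?r \<subseteq> set p" using ij by auto
  show "vwalk ?r (with_proj G)"
  proof (rule vwalkI)
    show "set ?r \<subseteq> verts (with_proj G)" using sub walk by (auto simp: vwalk_def)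
    show "set (vwalk_arcs ?r) \<subseteq> arcs_ends (with_proj G)"
    proof
      fix e assume "e \<in> set (vwalk_arcs ?r)"
      then obtain m where m: "e = (?r ! m, ?r ! Suc m)" "Suc m < length ?r"
        unfolding set_vwalk_arcs_nth by blast
      then have "e = (p ! (i + m), p ! Suc (i + m))" "Suc (i + m) < length p"
        using nth[of m] nth[of "Suc m"] ij by (auto simp del: upt_Suc)
      then show "e \<in> arcs_ends (with_proj G)" using vwalk_nth_arc[OF walk] by auto
    qed
    show "?r \<noteq> []" using ij by simp
  qed
  show "distinct ?r" unfolding distinct_map using ij dist
    by (auto simp: inj_on_def nth_eq_iff_index_eq)
  show "set ?r \<subseteq> set p" by (rule sub)
  show "hd ?r = p ! i" "last ?r = p ! j" "length ?r = Suc (j - i)"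
    using ij by (auto simp: hd_map hd_append Suc_diff_le)
qed

text \<open>Any other edge closes a cycle with a segment of the spine: a chord of the spine, a leaf
  with two feet, or an edge between two leaves.\<close>

lemma caterpillar_edges:
  assumes acyclic: "\<not> (\<exists>c. cycle c \<and> 3 \<le> length c)"
    and p: "vpath p (with_proj G)"
    and pos: "\<And>v. v \<in> pverts G \<Longrightarrow> pos v < length p \<and>
      (v = p ! pos v \<or> v \<notin> set p \<and> (v, p ! pos v) \<in> parcs G)"
    and xy: "(x, y) \<in> parcs G"
  shows "if pos x = pos y then x = p ! pos x \<or> y = p ! pos x
    else x = p ! pos x \<and> y = p ! pos y \<and> (pos x = Suc (pos y) \<or> pos y = Suc (pos x))"
proof -
  have closed: False
    if "vwalk r (with_proj G)" "distinct r" "3 \<le> length r" "(last r, hd r) \<in> parcs G" for r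
    using cycle_of_closed_vpath[of r] acyclic that by (auto simp: vpath_def)
  have chord: "j = Suc i" if ij: "i < j" "j < length p" and e: "(p ! i, p ! j) \<in> parcs G" for i j
  proof (rule ccontr)
    assume "j \<noteq> Suc i"
    obtain r where r: "vwalk r (with_proj G)" "distinct r" "hd r = p ! i" "last r = p ! j" "length r = Suc (j - i)"
      using vpath_segment[OF p, of i j] ij by auto
    moreover have "3 \<le> length r" using r(5) \<open>j \<noteq> Suc i\<close> ij by linarith
    ultimately show False using closed[of r] arcD[OF e] by simp
  qed
  have two_feet: False
    if x: "x \<notin> set p" and e: "(x, p ! i) \<in> parcs G" "(x, p ! j) \<in> parcs G" and ij: "i < j" "j < length p" for x i j
  proof -
    obtain r where r: "vwalk r (with_proj G)" "distinct r" "set r \<subseteq> set p" "hd r = p ! i" "last r = p ! j"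
      "length r = Suc (j - i)"
      using vpath_segment[OF p, of i j] ij by auto
    have "vwalk (x # r) (with_proj G)" using r e arcD[OF e(1)] by (intro vwalk_consI) auto
    moreover have "3 \<le> length (x # r)" "r \<noteq> []" "x \<notin> set r" using r(3,6) x ij by auto
    ultimately show False using closed[of "x # r"] r(2,5) arcD[OF e(2)] by simp
  qed
  have two_leaves: False
    if x: "x \<notin> set p" "y \<notin> set p" and e: "(x, p ! i) \<in> parcs G" "(y, p ! j) \<in> parcs G" "(x, y) \<in> parcs G"
      and ij: "i \<le> j" "j < length p" for x y i j
  proof -
    obtain r where r: "vwalk r (with_proj G)" "distinct r" "set r \<subseteq> set p" "hd r = p ! i" "last r = p ! j"
      "length r = Suc (j - i)"
      using vpath_segment[OF p, of i j] ij by auto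
    have ne: "r \<noteq> []" using r by auto
    have "vwalk (r @ [y]) (with_proj G)"
      using r(1,5) ne arcD[OF e(2)] by (auto simp: vwalk_def set_vwalk_arcs_snoc)
    then have "vwalk (x # r @ [y]) (with_proj G)"
      using r e arcD[OF e(1)] ne by (intro vwalk_consI) auto
    then show False using closed[of "x # r @ [y]"] r x ij arcD[OF e(3)] by auto
  qed
  have D: "x \<in> pverts G" "y \<in> pverts G" "x \<noteq> y" "(y, x) \<in> parcs G" using arcD[OF xy] by auto
  have mem: "v \<in> set p \<longleftrightarrow> v = p ! pos v" if "v \<in> pverts G" for v
  proof
    show "v = p ! pos v" if "v \<in> set p" using pos[OF \<open>v \<in> pverts G\<close>] that by auto
    have "p ! pos v \<in> set p" using pos[OF that] by auto
    then show "v \<in> set p" if "v = p ! pos v" using that by simp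
  qed
  note px = pos[OF D(1)] and py = pos[OF D(2)]
  consider "x \<in> set p" "y \<in> set p" | "x \<notin> set p" "y \<in> set p" | "x \<in> set p" "y \<notin> set p" | "x \<notin> set p" "y \<notin> set p"
    by blast
  then show ?thesis
  proof cases
    case 1
    then have eq: "x = p ! pos x" "y = p ! pos y" using mem D by auto
    then show ?thesis
      using chord[of "pos x" "pos y"] chord[of "pos y" "pos x"] xy D px py
      by (cases "pos x" "pos y" rule: linorder_cases) auto
  next
    case 2
    then have "y = p ! pos y" "(x, p ! pos x) \<in> parcs G" using mem D px by auto
    then have "pos x = pos y"
      using two_feet[of x "pos x" "pos y"] two_feet[of x "pos y" "pos x"] 2 xy px py
      by (cases "pos x" "pos y" rule: linorder_cases) auto
    then show ?thesis using \<open>y = p ! pos y\<close> by simp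
  next
    case 3
    then have "x = p ! pos x" "(y, p ! pos y) \<in> parcs G" using mem D py by auto
    then have "pos x = pos y"
      using two_feet[of y "pos x" "pos y"] two_feet[of y "pos y" "pos x"] 3 D px py
      by (cases "pos x" "pos y" rule: linorder_cases) auto
    then show ?thesis using \<open>x = p ! pos x\<close> by simp
  next
    case 4
    then have "(x, p ! pos x) \<in> parcs G" "(y, p ! pos y) \<in> parcs G" using mem D px py by auto
    then have False
      using two_leaves[of x y "pos x" "pos y"] two_leaves[of y x "pos y" "pos x"] 4 xy D px py
      by (cases "pos x \<le> pos y") auto
    then show ?thesis ..
  qed
qed

end

context conn_graph
begin

text \<open>By \<open>edges\<close>, the value of \<open>pos\<close> changes only on moving between
  consecutive spine vertices, so no walk from \<open>x\<close> to \<open>y\<close> misses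
  \<open>p ! i\<close>.\<close>

lemma gdist_through_spine:
  assumes edges: "\<And>x y. (x, y) \<in> parcs G \<Longrightarrow>
      if pos x = pos y then x = p ! pos x \<or> y = p ! pos x
      else x = p ! pos x \<and> y = p ! pos y \<and> (pos x = Suc (pos y) \<or> pos y = Suc (pos x))"
    and V: "x \<in> pverts G" "y \<in> pverts G"
    and i: "pos x \<le> i" "i \<le> pos y" "pos x < pos y"
  shows "gdist G x (p ! i) + gdist G (p ! i) y = gdist G x y"
proof (rule ccontr)
  assume "\<not> ?thesis"
  then have J: "joined_avoiding G {p ! i} x y" using V by (intro geodesic_joined) auto
  show False
  \<comment> \<open>Rising above \<open>i\<close> means leaving \<open>p ! i\<close>, so a walk
    missing it keeps \<open>pos\<close> at most \<open>i\<close>. If \<open>i = pos y\<close>,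
    reaching \<open>i\<close> from below means arriving at \<open>p ! i\<close>, so
    \<open>pos\<close> stays below \<open>i\<close>.\<close>
  proof (cases "i < pos y")
    case True
    have "pos y \<le> i"
      using J
    proof (induction rule: joined_avoiding_induct)
      case (step a b)
      then show ?case using edges[OF step(2)] by (cases "pos a = pos b"; cases "pos a = i") auto
    qed (fact i)
    then show False using True by simp
  next
    case False
    have "pos y < i"
      using J
    proof (induction rule: joined_avoiding_induct)
      case (step a b)
      then show ?case using edges[OF step(2)] by (cases "pos a = pos b"; cases "pos b = i") auto
    qed (use i False in simp)
    then show False using False i by simp
  qed
qed

lemma mci_le_caterpillar:
  assumes T: "caterpillar T" "pverts T = pverts G"
    and distort: "\<forall>x\<in>pverts G. \<forall>y\<in>pverts G. \<bar>int (gdist G x y) - int (gdist T x y)\<bar> \<le> int k"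
  shows "mci G \<le> 2 * k + 1"
proof -
  interpret T: conn_graph T
    using T(1) by (auto simp: caterpillar_def undirected_tree_def intro: conn_graph.intro conn_graph_axioms.intro)
  obtain p where p: "vpath p (with_proj T)" and cover: "\<forall>v\<in>pverts T. \<exists>x\<in>set p. gdist T v x \<le> 1"
    using T(1) unfolding caterpillar_def by blast
  have acyclic: "\<not> (\<exists>c. T.cycle c \<and> 3 \<le> length c)"
    using T(1) by (simp add: caterpillar_def undirected_tree_def)
  have pV: "p ! i \<in> pverts G" if "i < length p" for i
    using p that T(2) by (auto simp: vpath_def vwalk_def)
  \<comment> \<open>A spine vertex has its own index as foot; a vertex off the spine may be given
    any neighbour on it.\<close>
  define foot where "foot v i \<longleftrightarrow> i < length p \<and> (v = p ! i \<or> v \<notin> set p \<and> (v, p ! i) \<in> parcs T)" for v i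
  define pos where "pos v = (SOME i. foot v i)" for v
  have "\<exists>i. foot v i" if v: "v \<in> pverts G" for v
  proof (cases "v \<in> set p")
    case True
    then show ?thesis by (auto simp: foot_def in_set_conv_nth)
  next
    case False
    obtain x where "x \<in> set p" "gdist T v x \<le> 1" using cover v T(2) by blast
    then obtain i where i: "i < length p" "gdist T v (p ! i) \<le> 1" by (auto simp: in_set_conv_nth)
    have "p ! i \<in> set p" using i by simp
    then have "gdist T v (p ! i) \<noteq> 0" using T.gdist_eq_0_iff[of v "p ! i"] v T(2) pV[OF i(1)] False by auto
    then have "gdist T v (p ! i) = 1" using i by simp
    then have "(v, p ! i) \<in> parcs T" using T.gdist_eq_1_imp_arc v T(2) pV[OF i(1)] by simp
    then show ?thesis using False i by (auto simp: foot_def)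
  qed
  then have foot: "foot v (pos v)" if "v \<in> pverts G" for v
    unfolding pos_def using that by (metis someI_ex)
  have edges: "if pos x = pos y then x = p ! pos x \<or> y = p ! pos x
      else x = p ! pos x \<and> y = p ! pos y \<and> (pos x = Suc (pos y) \<or> pos y = Suc (pos x))"
    if "(x, y) \<in> parcs T" for x y
    using T.caterpillar_edges[OF acyclic p _ that, of pos] foot T(2) by (auto simp: foot_def)
  have near: "gdist T v (p ! pos v) \<le> 1" if "v \<in> pverts G" for v
    using foot[OF that] T.gdist_arc_le[of v "p ! pos v"] T.gdist_self[of v] that T(2)
    by (auto simp: foot_def)
  have lenpos: "pos v < length p" if "v \<in> pverts G" for v using foot[OF that] by (simp add: foot_def)
  have toT: "gdist T x y \<le> gdist G x y + k" and toG: "gdist G x y \<le> gdist T x y + k"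
    if "x \<in> pverts G" "y \<in> pverts G" for x y
    using distort that by force+
  have cross: "x \<in> disk G v (2 * k + 1) \<or> y \<in> disk G v (2 * k + 1)"
    if xy: "(x, y) \<in> parcs G" and v: "v \<in> pverts G" and pp: "pos x \<le> pos v" "pos v \<le> pos y" for x y v
  proof -
    let ?m = "p ! pos v"
    have D: "x \<in> pverts G" "y \<in> pverts G" "x \<noteq> y" using arcD[OF xy] by auto
    have m: "?m \<in> pverts G" using pV lenpos v by simp
    have txy: "gdist T x y \<le> k + 1" using toT[OF D(1,2)] gdist_arc_le[OF xy] by simp
    have via: "gdist G z v \<le> gdist T z ?m + 1 + k" if "z \<in> pverts G" for z
      using toG[OF that v] T.gdist_tri[of z ?m v] near[OF v] T.gdist_sym[of v ?m] that v m T(2) by simp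
    have "gdist G x v \<le> 2 * k + 1 \<or> gdist G y v \<le> 2 * k + 1"
    proof (cases "pos x < pos y")
      case True
      \<comment> \<open>The \<open>T\<close>-distances of \<open>x\<close> and \<open>y\<close> from
        \<open>?m\<close> add up to at most \<open>k + 1\<close>, so one of them is at most
        \<open>k\<close>, and \<open>via\<close> gives \<open>2 * k + 1\<close>.\<close>
      have "gdist T x ?m + gdist T ?m y = gdist T x y"
        using T.gdist_through_spine[OF edges _ _ pp True] D T(2) by simp
      then show ?thesis using via[OF D(1)] via[OF D(2)] txy T.gdist_sym[of ?m y] D m T(2) by auto
    next
      case False
      then have eq: "pos x = pos v" "pos y = pos v" using pp by auto
      show ?thesis
      \<comment> \<open>With equal feet \<open>via\<close> gives \<open>k + 2\<close>, which
        suffices for positive \<open>k\<close>. For \<open>k = 0\<close> the edge belongs to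
        \<open>T\<close>, so one of its ends is \<open>?m\<close> itself.\<close>
      proof (cases "k = 0")
        case True
        then have "gdist T x y = 1"
          using txy T.gdist_eq_0_iff[of x y] D T(2) by (cases "gdist T x y") auto
        then have "(x, y) \<in> parcs T" using T.gdist_eq_1_imp_arc D T(2) by simp
        then have "x = ?m \<or> y = ?m" using edges[of x y] eq by auto
        then show ?thesis using via[OF D(1)] via[OF D(2)] T.gdist_self[of ?m] m T(2) True by auto
      next
        case False
        then show ?thesis using via[OF D(1)] near[OF D(1)] eq by auto
      qed
    qed
    then show ?thesis using D by (simp add: disk_def)
  qed
  show ?thesis
  proof (rule mci_le_of_pos)
    fix u v w
    assume A: "u \<in> pverts G" "v \<in> pverts G" "w \<in> pverts G" "u \<noteq> w" "pos u \<le> pos v" "pos v \<le> pos w"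
    show "\<not> joined_avoiding G (disk G v (2 * k + 1)) u w"
    proof
      assume "joined_avoiding G (disk G v (2 * k + 1)) u w"
      \<comment> \<open>The start is exempted by \<open>w = u\<close>, since \<open>pos u\<close>
        may equal \<open>pos v\<close>. Every further vertex is strictly to the left of
        \<open>v\<close>, as an edge reaching or passing its position has an end in the
        disk.\<close>
      then have "w = u \<or> pos w < pos v"
      proof (induction rule: joined_avoiding_induct)
        case (step a b)
        have "pos a \<le> pos v" using step(5) A by auto
        then have "\<not> pos v \<le> pos b" using cross[OF step(2) A(2)] step(3,4) by blast
        then show ?case by simp
      qed simp
      then show False using A by auto
    qed
  qed
qed

end

theorem theorem4:
  fixes G :: "'a pair_pre_digraph"
  assumes "pair_graph G"
    and "Digraph_Component.connected (with_proj G)"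
    and "\<not> path_graph G"
  shows "mci G \<le> pl G \<and> pl G \<le> 2 * pat G \<and> 2 * int (pat G) \<le> 4 * int (mci G) - 2 \<and>
         mci G \<le> Delta G \<and> Delta G \<le> 4 * mci G \<and>
         (real (mci G) - 1) / 2 \<le> real (adc G) \<and> int (adc G) \<le> 4 * int (mci G) - 2"
proof -
  interpret conn_graph G using assms by (intro conn_graph.intro conn_graph_axioms.intro)
  \<comment> \<open>A positive index makes \<open>2 * mci G - 1\<close> a valid exponent for
    \<open>pat\<close>, the subtraction of natural numbers being exact.\<close>
  have r: "1 \<le> mci G" using mci_0_imp_path_graph assms(3) by (cases "mci G") auto
  have "\<exists>u\<in>pverts G. \<exists>v\<in>pverts G. u \<noteq> v"
  proof (rule ccontr)
    assume "\<not> ?thesis"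
    then have "mci G \<le> 0" by (intro mci_le_of_pos[of "\<lambda>_. 0"]) blast
    then show False using r by simp
  qed
  then have Delta_lower: "mci G \<le> Delta G" using mci_le_Delta by blast
  note k = pat_attained[OF r] and kr = pat_le[OF r]
  interpret H: conn_graph "graph_power G (pat G)" using k(1) by (rule conn_graph_power)
  obtain s where adm: "admissible (graph_power G (pat G)) s" using H.AT_free_imp_admissible[OF k(2)] .
  have s: "s \<in> pverts G" using adm by (simp add: admissible_def)
  have diam: "gdist G x y \<le> 2 * pat G"
    if "x \<in> pverts G" "y \<in> pverts G" "gdist G s x = gdist G s y" for x y
    using admissible_layer_diam[OF adm k(1) that] .
  \<comment> \<open>Since \<open>pat G\<close> is at most \<open>2 * mci G - 1\<close>, this is at
    most \<open>4 * mci G - 1\<close>.\<close>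
  have "Delta G \<le> Suc (2 * pat G)" using Delta_le[OF s diam] .
  moreover obtain T where T: "caterpillar T" "pverts T = pverts G"
    "\<forall>x\<in>pverts G. \<forall>y\<in>pverts G. \<bar>int (gdist G x y) - int (gdist T x y)\<bar> \<le> int (2 * pat G)"
    by (rule layering_caterpillar_distortion[OF s, of "2 * pat G"]) (use k(1) diam in auto)
  moreover have "adc G \<le> 2 * pat G" using adc_le[OF T] .
  moreover have "mci G \<le> 2 * adc G + 1" using adc_attained[OF T] mci_le_caterpillar by metis
  moreover have "pl G \<le> 2 * pat G" using pl_le_AT_free_power k by blast
  ultimately show ?thesis using mci_le_pl Delta_lower kr r by (auto simp: field_simps)
qed

end
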